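(* Let $q$ be an odd prime power, let $\mathbf{P}_1,\dots,\mathbf{P}_{q(q+1)/2}$ be the external points of the conic $\mathcal{O}$ in $PG(2,q)$, and let $\mathbf{B}$ be the integer $(0,1)$-matrix whose columns are labeled by $\mathbf{P}_1,\dots,\mathbf{P}_{q(q+1)/2}$, whose rows are labeled by the secant lines $\mathbf{P}_1^\perp,\dots,\mathbf{P}_{q(q+1)/2}^\perp$, and whose $(i,j)$-entry is $1$ if and only if $\mathbf{P}_j\in\mathbf{P}_i^\perp$. Then, entrywise, $$\mathbf{B}^5\equiv\mathbf{B}\pmod 2.$$ Moreover, if $q\equiv\pm3\pmod 8$, then $\mathbf{B}^3\equiv\mathbf{B}\pmod 2$.
   Context: $PG(2,q)$ is the projective plane over $\mathbb{F}_q$ with homogeneous coordinates; the point $(a_0,a_1,a_2)$ lies on the line $[b_0,b_1,b_2]$ iff $a_0b_0+a_1b_1+a_2b_2=0$. $\mathcal{O}=\{(1,t,t^2)\mid t\in\mathbb{F}_q\}\cup\{(0,0,1)\}$ is the conic $X_1^2-X_0X_2=0$. A line is secant (tangent, passant) if it meets $\mathcal{O}$ in exactly $2$ ($1$, $0$) points. A point is external (absolute, internal) if it lies on exactly $2$ ($1$, $0$) tangent lines. $\perp$ is the polarity sending the point $(x,y,z)$ to the line $[z,-2y,x]$; it gives a bijection from external points to secant lines. *)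

theory Defs
  imports "Jordan_Normal_Form.Matrix" "HOL-Number_Theory.Cong" "HOL-Library.Cardinality"
begin

text \<open>
  The field with \<open>q\<close> elements is a type \<open>'a\<close> of class \<open>field\<close> and \<open>finite\<close> with
  \<open>CARD('a) = q\<close>. Points and lines of the projective plane over \<open>'a\<close> are two separate
  quotients of the nonzero coordinate triples by proportionality.
\<close>

definition proportional :: "'a::field \<times> 'a \<times> 'a \<Rightarrow> 'a \<times> 'a \<times> 'a \<Rightarrow> bool" where
  "proportional = (\<lambda>(x, y, z) (x', y', z').
     (x, y, z) \<noteq> (0, 0, 0) \<and> (x', y', z') \<noteq> (0, 0, 0) \<and>
     (\<exists>c. c \<noteq> 0 \<and> x' = c * x \<and> y' = c * y \<and> z' = c * z))"

lemma part_equivp_proportional: "part_equivp (proportional :: 'a::field \<times> 'a \<times> 'a \<Rightarrow> _)"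
proof (rule part_equivpI)
  show "\<exists>v :: 'a \<times> 'a \<times> 'a. proportional v v"
    by (rule exI[of _ "(1, 0, 0)"]) (auto simp: proportional_def intro: exI[of _ 1])
  show "symp (proportional :: 'a \<times> 'a \<times> 'a \<Rightarrow> _)"
  proof (rule sympI)
    fix u v :: "'a \<times> 'a \<times> 'a"
    obtain x y z x' y' z' where uv: "u = (x, y, z)" "v = (x', y', z')"
      by (cases u, cases v) auto
    assume "proportional u v"
    then obtain c where c: "c \<noteq> 0" "x' = c * x" "y' = c * y" "z' = c * z"
      and nz: "u \<noteq> (0, 0, 0)" "v \<noteq> (0, 0, 0)"
      unfolding proportional_def uv by auto
    have "x = inverse c * x'" "y = inverse c * y'" "z = inverse c * z'" "inverse c \<noteq> 0"
      using c by (auto simp: field_simps)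
    then show "proportional v u"
      using nz unfolding proportional_def uv by blast
  qed
  show "transp (proportional :: 'a \<times> 'a \<times> 'a \<Rightarrow> _)"
  proof (rule transpI)
    fix u v w :: "'a \<times> 'a \<times> 'a"
    obtain x y z x' y' z' x'' y'' z''
      where uvw: "u = (x, y, z)" "v = (x', y', z')" "w = (x'', y'', z'')"
      by (cases u, cases v, cases w) auto
    assume uv: "proportional u v" and vw: "proportional v w"
    obtain c where c: "c \<noteq> 0" "x' = c * x" "y' = c * y" "z' = c * z"
      using uv unfolding proportional_def uvw by auto
    obtain d where d: "d \<noteq> 0" "x'' = d * x'" "y'' = d * y'" "z'' = d * z'"
      using vw unfolding proportional_def uvw by auto
    have "x'' = (d * c) * x" "y'' = (d * c) * y" "z'' = (d * c) * z" "d * c \<noteq> 0"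
      using c d by auto
    moreover have "u \<noteq> (0, 0, 0)" "w \<noteq> (0, 0, 0)"
      using uv vw unfolding proportional_def uvw by auto
    ultimately show "proportional u w"
      unfolding proportional_def uvw by blast
  qed
qed

quotient_type (overloaded) 'a point = "'a::field \<times> 'a \<times> 'a" / partial: proportional
  by (rule part_equivp_proportional)

quotient_type (overloaded) 'a line = "'a::field \<times> 'a \<times> 'a" / partial: proportional
  by (rule part_equivp_proportional)

lift_definition lies_on :: "'a::field point \<Rightarrow> 'a line \<Rightarrow> bool"
  is "\<lambda>(a0, a1, a2) (b0, b1, b2). a0 * b0 + a1 * b1 + a2 * b2 = 0"
proof -
  fix u u' v v' :: "'a \<times> 'a \<times> 'a"
  obtain a b c a' b' c' where u: "u = (a, b, c)" "u' = (a', b', c')"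
    by (cases u, cases u') auto
  obtain x y z x' y' z' where v: "v = (x, y, z)" "v' = (x', y', z')"
    by (cases v, cases v') auto
  assume "proportional u u'" "proportional v v'"
  then obtain k l where k: "k \<noteq> 0" "a' = k * a" "b' = k * b" "c' = k * c"
    and l: "l \<noteq> 0" "x' = l * x" "y' = l * y" "z' = l * z"
    unfolding proportional_def u v by auto
  have "a' * x' + b' * y' + c' * z' = (k * l) * (a * x + b * y + c * z)"
    unfolding k l by (simp add: algebra_simps)
  then show "(case u of (a0, a1, a2) \<Rightarrow> \<lambda>(b0, b1, b2). a0 * b0 + a1 * b1 + a2 * b2 = 0) v \<longleftrightarrow>
    (case u' of (a0, a1, a2) \<Rightarrow> \<lambda>(b0, b1, b2). a0 * b0 + a1 * b1 + a2 * b2 = 0) v'"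
    using k(1) l(1) unfolding u v by simp
qed

definition conic :: "'a::field point set" where
  "conic = {abs_point (1, t, t^2) | t. True} \<union> {abs_point (0, 0, 1)}"

definition secant :: "'a::field line \<Rightarrow> bool" where
  "secant l \<longleftrightarrow> card {X \<in> conic. lies_on X l} = 2"

definition tangent :: "'a::field line \<Rightarrow> bool" where
  "tangent l \<longleftrightarrow> card {X \<in> conic. lies_on X l} = 1"

definition external :: "'a::field point \<Rightarrow> bool" where
  "external X \<longleftrightarrow> card {l. tangent l \<and> lies_on X l} = 2"

text \<open>
  In characteristic 2 the image of \<open>(0, 1, 0)\<close> would be the zero triple, so the polarity
  cannot be lifted for all fields and is defined by way of a representative.
  The lemma below shows that the choice does not matter when \<open>2 \<noteq> 0\<close>.
\<close>

definition perp :: "'a::field point \<Rightarrow> 'a line" where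
  "perp X = (case rep_point X of (x, y, z) \<Rightarrow> abs_line (z, - 2 * y, x))"

lemma perp_abs_point:
  fixes x y z :: "'a::field"
  assumes two: "(2 :: 'a) \<noteq> 0" and nz: "(x, y, z) \<noteq> (0, 0, 0)"
  shows "perp (abs_point (x, y, z)) = abs_line (z, - 2 * y, x)"
proof -
  obtain x' y' z' where r: "rep_point (abs_point (x, y, z)) = (x', y', z')"
    by (cases "rep_point (abs_point (x, y, z))") auto
  have "proportional (x, y, z) (x, y, z)"
    using nz by (auto simp: proportional_def intro: exI[of _ 1])
  then have "proportional (rep_point (abs_point (x, y, z))) (x, y, z)"
    by (rule Quotient3_rep_abs[OF Quotient3_point])
  then obtain c where c: "c \<noteq> 0" "x = c * x'" "y = c * y'" "z = c * z'"
    and nz': "(x', y', z') \<noteq> (0, 0, 0)"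
    unfolding r proportional_def by auto
  have "proportional (z', - 2 * y', x') (z, - 2 * y, x)"
    unfolding proportional_def using c nz nz' two by (auto intro!: exI[of _ c])
  then have "abs_line (z', - 2 * y', x') = abs_line (z, - 2 * y, x)"
    by (rule Quotient3_rel_abs[OF Quotient3_line])
  then show ?thesis
    by (simp add: perp_def r)
qed

text \<open>
  Columns are labelled by the points \<open>P 0, \<dots>, P (n - 1)\<close> and rows by the lines
  \<open>perp (P 0), \<dots>, perp (P (n - 1))\<close>; matrix indices start at 0.
\<close>

definition incidence_mat :: "nat \<Rightarrow> (nat \<Rightarrow> 'a::field point) \<Rightarrow> int mat" where
  "incidence_mat n P = mat n n (\<lambda>(i, j). if lies_on (P j) (perp (P i)) then 1 else 0)"

end

theory Submission
  imports Defs "HOL-Library.Product_Plus" "HOL-Algebra.Multiplicative_Group"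
begin

text \<open>
  Let \<open>Q(x, y, z) = y\<^sup>2 - x z\<close> with polar form \<open>\<langle>u, v\<rangle>\<close>. The external points are the vectors with
  \<open>Q = 1\<close> up to sign, and \<open>P\<^sub>j\<close> lies on the polar of \<open>P\<^sub>i\<close> iff \<open>\<langle>p\<^sub>i, p\<^sub>j\<rangle> = 0\<close>. The entries of \<open>B\<^sup>3\<close> count
  the paths \<open>(k, l)\<close> from \<open>i\<close> to \<open>j\<close> in the orthogonality graph. The reflection exchanging
  \<open>u = \<plusminus>p\<^sub>i\<close> and \<open>v = p\<^sub>j\<close> reverses these paths, so modulo 2 only the reversible ones count, and these
  correspond to the \<open>k\<close> with \<open>\<langle>p\<^sub>k, u\<rangle> = 0\<close> and \<open>\<langle>p\<^sub>k, v\<rangle>\<^sup>2 = 2 (2 - \<langle>u, v\<rangle>)\<close>. A second reflection shows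
  that their number is odd iff \<open>\<langle>u, v\<rangle> = 0\<close>, or 2 is a square and the line \<open>P\<^sub>iP\<^sub>j\<close> is tangent. Hence
  \<open>B\<^sup>3 = B + T\<close> modulo 2, where \<open>T\<close> is the tangency matrix if 2 is a square and \<open>T = 0\<close>
  otherwise. In the same way \<open>T B = T\<close>, so \<open>B\<^sup>5 = (B + T) B\<^sup>2 = B\<^sup>3 + T = B\<close>. Finally, if 2 is a
  square, the circle \<open>x\<^sup>2 + y\<^sup>2 = 1\<close>, a group of order \<open>q \<plusminus> 1\<close>, contains an element of order 8,
  which is impossible for \<open>q \<equiv> \<plusminus>3\<close> modulo 8.
\<close>

section \<open>Parity by involutions, and fields of odd order\<close>

text \<open>The points moved by \<open>f\<close> pair off as \<open>{x, f x}\<close>; the induction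
  removes one such pair.\<close>

lemma even_card_involution:
  assumes "finite A" and "\<And>x. x \<in> A \<Longrightarrow> f x \<in> A" and "\<And>x. x \<in> A \<Longrightarrow> f (f x) = x"
  shows "even (card A) \<longleftrightarrow> even (card {x \<in> A. f x = x})"
  using assms
proof (induction A rule: finite_psubset_induct)
  case (psubset A)
  show ?case
  proof (cases "\<exists>x\<in>A. f x \<noteq> x")
    case False
    then have "{x \<in> A. f x = x} = A" by auto
    then show ?thesis by simp
  next
    case True
    then obtain x where x: "x \<in> A" "f x \<noteq> x" by auto
    let ?A = "A - {x, f x}"
    have fx: "f x \<in> A" "f (f x) = x" using psubset.prems x by auto
    have "even (card ?A) \<longleftrightarrow> even (card {y \<in> ?A. f y = y})"
    proof (rule psubset.IH)
      show "?A \<subset> A" using x by auto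
      show "f y \<in> ?A" if "y \<in> ?A" for y
        using that psubset.prems x fx by (metis Diff_iff insert_iff singletonD)
      show "f (f y) = y" if "y \<in> ?A" for y
        using that psubset.prems by auto
    qed
    moreover have "{y \<in> ?A. f y = y} = {y \<in> A. f y = y}" using x fx by auto
    moreover have "card A = card ?A + 2"
    proof -
      have "card {x, f x} = 2" using x by simp
      moreover have "card ?A = card A - card {x, f x}"
        using x fx by (intro card_Diff_subset) auto
      moreover have "card {x, f x} \<le> card A"
        using psubset.hyps x fx by (intro card_mono) auto
      ultimately show ?thesis by simp
    qed
    ultimately show ?thesis by simp
  qed
qed

text \<open>In characteristic 2, adding 1 is an involution of the field without fixed points, so the
  order would be even.\<close>

lemma two_neq_zero_of_odd_card:
  assumes "odd CARD('a::{field,finite})"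
  shows "(2 :: 'a) \<noteq> 0"
proof
  assume two: "(2 :: 'a) = 0"
  have "x + 1 + 1 = x" for x :: 'a using two by (simp add: add.assoc)
  then have "even CARD('a) \<longleftrightarrow> even (card {x \<in> (UNIV :: 'a set). x + 1 = x})"
    by (intro even_card_involution) auto
  then show False using assms by simp
qed

lemma four_neq_zero: "(2 :: 'a::field) \<noteq> 0 \<Longrightarrow> (4 :: 'a) \<noteq> 0"
  using power_not_zero[of "2 :: 'a" 2] by simp

lemma card_square_roots:
  fixes d :: "'a::{field,finite}"
  assumes "(2 :: 'a) \<noteq> 0"
  shows "card {w. w\<^sup>2 = d} = (if d = 0 then 1 else if \<exists>e. d = e\<^sup>2 then 2 else 0)"
proof (cases "\<exists>e. d = e\<^sup>2")
  case True
  then obtain e where e: "d = e\<^sup>2" by auto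
  have "e \<noteq> - e" if "e \<noteq> 0"
    using assms that by (metis add.right_inverse mult_2 mult_eq_0_iff)
  moreover have "{w. w\<^sup>2 = d} = {e, - e}" by (auto simp: e power2_eq_iff)
  ultimately show ?thesis using e by auto
next
  case False
  then have "d \<noteq> 0" by (metis power_zero_numeral)
  moreover have "{w. w\<^sup>2 = d} = {}" using False by auto
  ultimately show ?thesis using False by simp
qed

section \<open>The quadratic character of 2\<close>

text \<open>The elements \<open>x + i y\<close> of norm 1, where \<open>i\<close> is a formal square
  root of \<open>- 1\<close>.\<close>

definition circle :: "('a::field \<times> 'a) monoid" where
  "circle = \<lparr>carrier = {(x, y). x\<^sup>2 + y\<^sup>2 = 1},
    mult = (\<lambda>(x, y) (x', y'). (x * x' - y * y', x * y' + y * x')), one = (1, 0)\<rparr>"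

lemma circle_simps [simp]:
  "(x, y) \<in> carrier circle \<longleftrightarrow> x\<^sup>2 + y\<^sup>2 = 1"
  "(x, y) \<otimes>\<^bsub>circle\<^esub> (x', y') = (x * x' - y * y', x * y' + y * x')"
  "\<one>\<^bsub>circle\<^esub> = (1, 0)"
  by (simp_all add: circle_def)

lemma group_circle: "group (circle :: ('a::field \<times> 'a) monoid)"
proof (rule groupI)
  fix u v w :: "'a \<times> 'a"
  obtain a b c d e f where [simp]: "u = (a, b)" "v = (c, d)" "w = (e, f)"
    by (cases u, cases v, cases w) auto
  show "u \<otimes>\<^bsub>circle\<^esub> v \<in> carrier circle" if "u \<in> carrier circle" "v \<in> carrier circle"
  proof -
    \<comment> \<open>Multiplicativity of the norm.\<close>
    have "(a * c - b * d)\<^sup>2 + (a * d + b * c)\<^sup>2 = (a\<^sup>2 + b\<^sup>2) * (c\<^sup>2 + d\<^sup>2)"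
      by (simp add: power2_eq_square algebra_simps)
    then show ?thesis using that by simp
  qed
  show "u \<otimes>\<^bsub>circle\<^esub> v \<otimes>\<^bsub>circle\<^esub> w = u \<otimes>\<^bsub>circle\<^esub> (v \<otimes>\<^bsub>circle\<^esub> w)"
    by (simp add: algebra_simps)
  show "\<one>\<^bsub>circle\<^esub> \<otimes>\<^bsub>circle\<^esub> u = u" by simp
  show "\<exists>v\<in>carrier circle. v \<otimes>\<^bsub>circle\<^esub> u = \<one>\<^bsub>circle\<^esub>" if "u \<in> carrier circle"
    using that by (intro bexI[of _ "(a, - b)"]) (simp_all add: power2_eq_square algebra_simps)
qed (simp)

text \<open>Stereographic projection from \<open>(1, 0)\<close>.\<close>

lemma card_circle:
  assumes "(2 :: 'a::{field,finite}) \<noteq> 0"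
  shows "card (carrier (circle :: ('a \<times> 'a) monoid)) = CARD('a) + 1 \<or>
    card (carrier (circle :: ('a \<times> 'a) monoid)) + 1 = CARD('a)"
proof -
  let ?C = "carrier (circle :: ('a \<times> 'a) monoid)"
  \<comment> \<open>The parameters at which the denominator \<open>t\<^sup>2 + 1\<close> of the
    inverse map vanishes.\<close>
  let ?Z = "{t :: 'a. t\<^sup>2 = - 1}"
  have "bij_betw (\<lambda>(x, y). y / (1 - x)) (?C - {(1, 0)}) (- ?Z)"
  proof (rule bij_betw_byWitness[where f' = "\<lambda>t. ((t\<^sup>2 - 1) / (t\<^sup>2 + 1), 2 * t / (t\<^sup>2 + 1))"])
    have nz: "1 - x \<noteq> 0" "(y / (1 - x))\<^sup>2 + 1 = 2 / (1 - x)" "2 / (1 - x) \<noteq> 0"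
      if "x\<^sup>2 + y\<^sup>2 = 1" "(x, y) \<noteq> (1, 0)" for x y :: 'a
    proof -
      show x: "1 - x \<noteq> 0" using that by auto
      have "y\<^sup>2 = (1 - x) * (1 + x)" using that by (simp add: power2_eq_square algebra_simps)
      then show "(y / (1 - x))\<^sup>2 + 1 = 2 / (1 - x)"
        using x by (simp add: power_divide power2_eq_square divide_simps)
      show "2 / (1 - x) \<noteq> 0" using x assms by simp
    qed
    show "\<forall>c\<in>?C - {(1, 0)}. (\<lambda>t. ((t\<^sup>2 - 1) / (t\<^sup>2 + 1), 2 * t / (t\<^sup>2 + 1)))
      (case c of (x, y) \<Rightarrow> y / (1 - x)) = c"
    proof
      fix c :: "'a \<times> 'a" assume "c \<in> ?C - {(1, 0)}"
      then obtain x y where c: "(x, y) \<in> carrier circle" "(x, y) \<noteq> (1, 0)" and xy: "c = (x, y)"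
        by (cases c) auto
      define t where "t = y / (1 - x)"
      have t: "t\<^sup>2 + 1 = 2 / (1 - x)" "1 - x \<noteq> 0" using nz[of x y] c by (auto simp: t_def)
      have "t\<^sup>2 - 1 = 2 / (1 - x) - 2" using t by (simp add: algebra_simps)
      then have "(t\<^sup>2 - 1) / (t\<^sup>2 + 1) = (2 / (1 - x) - 2) / (2 / (1 - x))"
        using t by simp
      also have "\<dots> = x" using t(2) assms by (simp add: divide_simps)
      finally have "(t\<^sup>2 - 1) / (t\<^sup>2 + 1) = x" .
      moreover have "2 * t / (t\<^sup>2 + 1) = y"
        unfolding t(1) using t(2) assms by (simp add: t_def)
      ultimately show "(\<lambda>t. ((t\<^sup>2 - 1) / (t\<^sup>2 + 1), 2 * t / (t\<^sup>2 + 1)))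
        (case c of (x, y) \<Rightarrow> y / (1 - x)) = c"
        by (simp add: xy t_def)
    qed
    have pos: "t\<^sup>2 + 1 \<noteq> 0" if "t \<in> - ?Z" for t :: 'a
      using that by (auto simp: eq_neg_iff_add_eq_0)
    show "\<forall>t\<in>- ?Z. (case ((t\<^sup>2 - 1) / (t\<^sup>2 + 1), 2 * t / (t\<^sup>2 + 1)) of (x, y) \<Rightarrow> y / (1 - x)) = t"
    proof
      fix t :: 'a assume t: "t \<in> - ?Z"
      have "1 - (t\<^sup>2 - 1) / (t\<^sup>2 + 1) = 2 / (t\<^sup>2 + 1)"
        using pos[OF t] by (simp add: divide_simps)
      then show "(case ((t\<^sup>2 - 1) / (t\<^sup>2 + 1), 2 * t / (t\<^sup>2 + 1)) of (x, y) \<Rightarrow> y / (1 - x)) = t"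
        using pos[OF t] assms by simp
    qed
    show "(\<lambda>(x, y). y / (1 - x)) ` (?C - {(1, 0)}) \<subseteq> - ?Z"
    proof (rule image_subsetI)
      fix c :: "'a \<times> 'a" assume "c \<in> ?C - {(1, 0)}"
      then show "(case c of (x, y) \<Rightarrow> y / (1 - x)) \<in> - ?Z"
        using nz[of "fst c" "snd c"] by (cases c) (auto simp: eq_neg_iff_add_eq_0)
    qed
    show "(\<lambda>t. ((t\<^sup>2 - 1) / (t\<^sup>2 + 1), 2 * t / (t\<^sup>2 + 1))) ` (- ?Z) \<subseteq> ?C - {(1, 0)}"
    proof
      fix c :: "'a \<times> 'a"
      assume "c \<in> (\<lambda>t. ((t\<^sup>2 - 1) / (t\<^sup>2 + 1), 2 * t / (t\<^sup>2 + 1))) ` (- ?Z)"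
      then obtain t where t: "t \<in> - ?Z" "c = ((t\<^sup>2 - 1) / (t\<^sup>2 + 1), 2 * t / (t\<^sup>2 + 1))" by auto
      have "(t\<^sup>2 - 1)\<^sup>2 + (2 * t)\<^sup>2 = (t\<^sup>2 + 1)\<^sup>2" by (simp add: power2_eq_square algebra_simps)
      then have "c \<in> ?C"
        using pos[OF t(1)] by (simp add: t(2) power_divide add_divide_distrib[symmetric])
      moreover have "(t\<^sup>2 - 1) / (t\<^sup>2 + 1) \<noteq> 1"
      proof
        assume "(t\<^sup>2 - 1) / (t\<^sup>2 + 1) = 1"
        then have "t\<^sup>2 - 1 = t\<^sup>2 + 1" using pos[OF t(1)] by simp
        then have "2 = (0::'a)" by (simp add: algebra_simps)
        then show False using assms by simp
      qed
      ultimately show "c \<in> ?C - {(1, 0)}" by (simp add: t(2))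
    qed
  qed
  then have "card (?C - {(1, 0)}) = card (- ?Z)" by (rule bij_betw_same_card)
  moreover have "card (?C - {(1, 0)}) = card ?C - 1" by (rule card_Diff_singleton) simp
  moreover have "card ?C > 0"
  proof -
    have "(1, 0) \<in> ?C" by simp
    then show ?thesis by (metis card_gt_0_iff empty_iff finite_class.finite)
  qed
  moreover have "card (- ?Z) = CARD('a) - card ?Z"
    by (simp add: Compl_eq_Diff_UNIV card_Diff_subset)
  moreover have "card ?Z \<le> CARD('a)" by (intro card_mono) auto
  \<comment> \<open>As \<open>- 1\<close> is nonzero, it has no square root or two; the circle has
    \<open>q + 1\<close> or \<open>q - 1\<close> points accordingly.\<close>
  moreover have "card ?Z = 0 \<or> card ?Z = 2" using card_square_roots[OF assms, of "- 1"] by simp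
  moreover have "CARD('a) > 0" by simp
  ultimately show ?thesis by linarith
qed

text \<open>If \<open>r\<^sup>2 = 2\<close>, then \<open>(1/r, 1/r)\<close> is a rotation by 45 degrees, of order 8.\<close>

lemma card_mod_8_if_two_square:
  assumes two: "(2 :: 'a::{field,finite}) \<noteq> 0" and r: "(r :: 'a)\<^sup>2 = 2"
  shows "CARD('a) mod 8 = 1 \<or> CARD('a) mod 8 = 7"
proof -
  interpret group "circle :: ('a \<times> 'a) monoid" by (rule group_circle)
  define s where "s = 1 / r"
  have s: "2 * (s * s) = 1" using r two by (simp add: s_def power2_eq_square[symmetric] power_divide)
  define c where "c = (s, s)"
  have c: "c \<in> carrier circle" using s by (simp add: c_def power2_eq_square algebra_simps)
  have c2: "c [^]\<^bsub>circle\<^esub> (2::nat) = (0, 1)"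
    using s by (simp add: numeral_2_eq_2 c_def algebra_simps)
  have c4: "c [^]\<^bsub>circle\<^esub> (4::nat) = (- 1, 0)"
    using nat_pow_mult[OF c, of 2 2, symmetric] by (simp add: c2)
  have c8: "c [^]\<^bsub>circle\<^esub> (8::nat) = \<one>\<^bsub>circle\<^esub>"
    using nat_pow_mult[OF c, of 4 4, symmetric] by (simp add: c4)
  have "ord c dvd 2 ^ 3" using pow_eq_id[OF c, of 8] c8 by simp
  then obtain k where k: "k \<le> 3" "ord c = 2 ^ k"
    by (metis divides_primepow_nat two_is_prime_nat)
  \<comment> \<open>The fourth power of \<open>c\<close> is \<open>(- 1, 0)\<close>, which differs
    from the unit in odd characteristic; so the order divides 8 but not 4.\<close>
  have "\<not> ord c dvd 4"
  proof
    assume "ord c dvd 4"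
    then have "(- 1 :: 'a) = 1" using pow_eq_id[OF c, of 4] c4 by simp
    then have "(1 :: 'a) + 1 = 0" by (metis add.right_inverse)
    then show False using two by simp
  qed
  then have "\<not> (2::nat) ^ k dvd 2 ^ 2" using k by simp
  then have "\<not> k \<le> 2" using le_imp_power_dvd by blast
  then have "ord c = 8" using k by (simp add: le_antisym not_less_eq_eq numeral_3_eq_3)
  then have "8 dvd card (carrier (circle :: ('a \<times> 'a) monoid))"
    using ord_dvd_group_order[OF c] by (simp add: order_def)
  then show ?thesis using card_circle[OF two] by presburger
qed

section \<open>The quadratic form of the conic\<close>

type_synonym 'a vec3 = "'a \<times> 'a \<times> 'a"

fun scl :: "'a::field \<Rightarrow> 'a vec3 \<Rightarrow> 'a vec3" where
  "scl c (x, y, z) = (c * x, c * y, c * z)"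

fun qf :: "'a::field vec3 \<Rightarrow> 'a" where
  "qf (x, y, z) = y\<^sup>2 - x * z"

fun bf :: "'a::field vec3 \<Rightarrow> 'a vec3 \<Rightarrow> 'a" where
  "bf (x, y, z) (x', y', z') = 2 * y * y' - x * z' - z * x'"

lemma bf_commute: "bf u v = bf v u"
  by (cases u; cases v) (simp add: algebra_simps)

lemma bf_linear [simp]:
  "bf (u + v) w = bf u w + bf v w" "bf (u - v) w = bf u w - bf v w"
  "bf (- u) w = - bf u w" "bf (scl c u) w = c * bf u w"
  "bf w (u + v) = bf w u + bf w v" "bf w (u - v) = bf w u - bf w v"
  "bf w (- u) = - bf w u" "bf w (scl c u) = c * bf w u"
  by (cases u; cases v; cases w; simp add: algebra_simps)+

lemma bf_zero [simp]: "bf 0 u = 0" "bf u 0 = 0"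
  by (cases u; simp add: zero_prod_def)+

lemma qf_zero [simp]: "qf 0 = 0"
  by (simp add: zero_prod_def)

lemma bf_self: "bf u u = 2 * qf u"
  by (cases u) (simp add: power2_eq_square algebra_simps)

lemma qf_add: "qf (u + v) = qf u + bf u v + qf v"
  and qf_diff: "qf (u - v) = qf u - bf u v + qf v"
  by (cases u; cases v; simp add: power2_eq_square algebra_simps)+

lemma qf_uminus [simp]: "qf (- u) = qf u"
  and qf_scl [simp]: "qf (scl c u) = c\<^sup>2 * qf u"
  by (cases u; simp add: power2_eq_square algebra_simps)+

lemma scl_simps [simp]:
  "scl c (scl d u) = scl (c * d) u" "scl 1 u = u" "scl 0 u = 0" "scl (- 1) u = - u"
  by (cases u; simp add: zero_prod_def)+

lemma scl_add_left: "scl (c + d) u = scl c u + scl d u"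
  and scl_diff_left: "scl (c - d) u = scl c u - scl d u"
  and scl_minus_left: "scl (- c) u = - scl c u"
  by (cases u; simp add: algebra_simps)+

text \<open>Pairing \<open>u\<close> with the standard basis vectors recovers its coordinates up to
  sign, the middle one up to the factor 2.\<close>

lemma bf_nondegenerate:
  assumes "(2 :: 'a::field) \<noteq> 0" "(u :: 'a vec3) \<noteq> 0"
  obtains v where "bf v u \<noteq> 0"
proof -
  obtain x y z where u: "u = (x, y, z)" by (cases u) auto
  have "bf (0, 0, 1) u = - x" "bf (0, 1, 0) u = 2 * y" "bf (1, 0, 0) u = - z"
    by (simp_all add: u)
  moreover have "x \<noteq> 0 \<or> y \<noteq> 0 \<or> z \<noteq> 0" using assms(2) by (auto simp: u zero_prod_def)
  ultimately show ?thesis using that assms(1) by (metis neg_equal_0_iff_equal mult_eq_0_iff)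
qed

text \<open>The determinant is shown to be nonzero by way of the Gram matrix of \<open>(u, v, w)\<close>.\<close>

lemma orthogonal_to_basis:
  assumes two: "(2 :: 'a::field) \<noteq> 0"
    and uv: "bf u v = 0" and uw: "bf u w = 0" and u: "qf u \<noteq> 0"
    and v: "qf v = 0" and vw: "bf v w \<noteq> (0 :: 'a)"
    and z: "bf z u = 0" "bf z v = 0" "bf z w = 0"
  shows "z = 0"
proof -
  obtain u1 u2 u3 v1 v2 v3 w1 w2 w3 z1 z2 z3 where
    e: "u = (u1, u2, u3)" "v = (v1, v2, v3)" "w = (w1, w2, w3)" "z = (z1, z2, z3)"
    by (cases u, cases v, cases w, cases z) auto
  define D where "D = u1 * (v2 * w3 - v3 * w2) - u2 * (v1 * w3 - v3 * w1) + u3 * (v1 * w2 - v2 * w1)"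
  \<comment> \<open>The right side is minus the Gram determinant; the factor 2 comes from the
    determinant \<open>- 2\<close> of \<open>bf\<close> in the standard basis. Under the hypotheses
    only the first summand survives.\<close>
  have "2 * D\<^sup>2 = 2 * qf u * (bf v w)\<^sup>2 - 8 * qf u * qf v * qf w
      - 2 * bf u v * bf v w * bf u w + 2 * qf v * (bf u w)\<^sup>2 + 2 * qf w * (bf u v)\<^sup>2"
    unfolding D_def e qf.simps bf.simps by (simp add: power2_eq_square algebra_simps)
  then have "D \<noteq> 0" using two uv uw u v vw by auto
  \<comment> \<open>Cramer's rule: the coordinates of \<open>z\<close> from its pairings with
    \<open>u\<close>, \<open>v\<close>, \<open>w\<close>.\<close>
  have "D * (2 * z2) = bf z u * (v3 * w1 - v1 * w3) + bf z v * (w3 * u1 - w1 * u3)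
      + bf z w * (u3 * v1 - u1 * v3)"
    and "D * z1 = - (bf z u * (v1 * w2 - v2 * w1) + bf z v * (w1 * u2 - w2 * u1)
      + bf z w * (u1 * v2 - u2 * v1))"
    and "D * z3 = - (bf z u * (v2 * w3 - v3 * w2) + bf z v * (w2 * u3 - w3 * u2)
      + bf z w * (u2 * v3 - u3 * v2))"
    unfolding D_def e bf.simps by (simp_all add: algebra_simps)
  then have "D * (2 * z2) = 0" "D * z1 = 0" "D * z3 = 0" by (simp_all only: z) simp_all
  then show ?thesis using \<open>D \<noteq> 0\<close> two by (simp add: e zero_prod_def)
qed

section \<open>Reflections of the quadratic form\<close>

text \<open>The orthogonal reflection negating \<open>w\<close>: because
  \<open>bf w w = 2 * qf w\<close>, the coefficient is the usual
  \<open>2 * bf x w / bf w w\<close>.\<close>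

definition reflect :: "'a::field vec3 \<Rightarrow> 'a vec3 \<Rightarrow> 'a vec3" where
  "reflect w x = x - scl (bf x w / qf w) w"

lemma reflect_uminus [simp]: "reflect w (- x) = - reflect w x"
  by (simp add: reflect_def scl_minus_left)

lemma bf_reflect:
  assumes "qf w \<noteq> 0"
  shows "bf (reflect w x) (reflect w y) = bf x y"
  using assms by (simp add: reflect_def bf_self bf_commute[of w] field_simps)

lemma qf_reflect:
  assumes "qf w \<noteq> 0"
  shows "qf (reflect w x) = qf x"
  using assms by (simp add: reflect_def qf_diff power2_eq_square field_simps)

lemma reflect_reflect:
  assumes "qf w \<noteq> 0"
  shows "reflect w (reflect w x) = x"
proof -
  have "bf (reflect w x) w / qf w = - (bf x w / qf w)"
    using assms by (simp add: reflect_def bf_self field_simps)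
  then show ?thesis by (simp add: reflect_def[of w "reflect w x"] scl_minus_left) (simp add: reflect_def)
qed

lemma bf_reflect_left:
  assumes "qf w \<noteq> 0"
  shows "bf (reflect w x) y = bf x (reflect w y)"
  using bf_reflect[OF assms, of x "reflect w y"] reflect_reflect[OF assms] by simp

text \<open>The difference \<open>x - reflect w x\<close> is always a multiple of \<open>w\<close>,
  and here it equals \<open>x + x\<close>. The explicit factor later allows \<open>qf x\<close> to
  be computed.\<close>

lemma reflect_eq_uminus:
  assumes two: "(2 :: 'a::field) \<noteq> 0" and w: "reflect w x = - (x :: 'a vec3)"
  shows "x = scl (bf x w / 2 / qf w) w"
proof -
  have "x + x = scl (bf x w / qf w) w" using w by (simp add: reflect_def algebra_simps)
  moreover have "x + x = scl 2 x" using scl_add_left[of 1 1 x] by simp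
  ultimately have "scl (1 / 2) (scl 2 x) = scl (1 / 2) (scl (bf x w / qf w) w)" by simp
  then show ?thesis using two by simp
qed

text \<open>As \<open>qf u = qf v\<close>, the vector \<open>u + v\<close> is orthogonal to
  \<open>u - v\<close>, so negating the latter exchanges \<open>u\<close> and \<open>v\<close>.
  Since \<open>qf (u - v) = 2 - bf u v\<close>, the third hypothesis makes the reflection
  available.\<close>

lemma reflect_swap:
  assumes "qf u = 1" "qf v = 1" "bf u v \<noteq> 2"
  shows "qf (u - v) \<noteq> 0" "reflect (u - v) u = v" "reflect (u - v) v = u"
proof -
  have q: "qf (u - v) = 2 - bf u v" using assms by (simp add: qf_diff)
  show nz: "qf (u - v) \<noteq> 0" using q assms by auto
  have "bf u (u - v) / qf (u - v) = 1" "bf v (u - v) / qf (u - v) = - 1"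
    using nz assms by (simp_all add: q bf_self bf_commute[of v u] divide_simps)
  then show "reflect (u - v) u = v" "reflect (u - v) v = u" by (simp_all add: reflect_def)
qed

text \<open>The \<open>x\<close> orthogonal to \<open>u\<close> with \<open>bf x w = h\<close> form an affine line parallel to the isotropic vector
  \<open>w\<close>, on which \<open>qf\<close> is a polynomial of degree 1.\<close>

lemma ex1_on_isotropic_line:
  assumes two: "(2 :: 'a::field) \<noteq> 0"
    and u: "qf u = 1" and w: "qf w = 0" "w \<noteq> 0" and uw: "bf u w = 0" and h: "h \<noteq> (0 :: 'a)"
  shows "\<exists>!x. bf x u = 0 \<and> bf x w = h \<and> qf x = 1"
proof -
  obtain y where y: "bf y w \<noteq> 0" using bf_nondegenerate[OF two w(2)] .
  \<comment> \<open>Make \<open>y\<close> orthogonal to \<open>u\<close>, which leaves its pairing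
    with \<open>w\<close> unchanged, then rescale that pairing to \<open>h\<close>.\<close>
  define y' where "y' = scl (h / bf y w) (y - scl (bf y u / 2) u)"
  have y': "bf y' u = 0" "bf y' w = h"
    using y two by (simp_all add: y'_def bf_self u uw)
  \<comment> \<open>Adding \<open>scl t w\<close> to \<open>y'\<close> changes \<open>qf\<close> by
    \<open>t * h\<close>, because \<open>w\<close> is isotropic.\<close>
  define x where "x = y' + scl ((1 - qf y') / h) w"
  have x: "bf x u = 0" "bf x w = h" "qf x = 1"
    using y' h w uw by (simp_all add: x_def bf_self bf_commute[of w] qf_add)
  show ?thesis
  proof (rule ex1I[of _ x])
    show "bf x u = 0 \<and> bf x w = h \<and> qf x = 1" using x by simp
    fix x' assume x': "bf x' u = 0 \<and> bf x' w = h \<and> qf x' = 1"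
    \<comment> \<open>Chosen so that \<open>x' - x - scl c w\<close> is also orthogonal to
      \<open>x\<close>, hence to the basis \<open>u\<close>, \<open>w\<close>, \<open>x\<close>.
      Comparing \<open>qf x'\<close> with \<open>qf x\<close> then gives
      \<open>c * h = 0\<close>.\<close>
    define c where "c = bf (x' - x) x / h"
    have "x' - x - scl c w = 0"
    proof (rule orthogonal_to_basis[OF two])
      show "bf u w = 0" "bf u x = 0" "qf u \<noteq> 0" "qf w = 0" "bf w x \<noteq> 0"
        using x u w uw h by (simp_all add: bf_commute[of _ x])
      show "bf (x' - x - scl c w) u = 0" "bf (x' - x - scl c w) w = 0"
        using x x' uw w by (simp_all add: bf_self bf_commute[of w u])
      show "bf (x' - x - scl c w) x = 0"
        using x h by (simp add: c_def bf_commute[of w x])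
    qed
    then have e: "x' = x + scl c w" by (simp add: algebra_simps)
    then have "c * h = 0" using x x' w by (simp add: qf_add)
    then show "x' = x" using h e by simp
  qed
qed

section \<open>Unit vectors up to sign, as vertices of the orthogonality graph\<close>

text \<open>An external point has exactly two representatives with \<open>qf = 1\<close>, which
  differ by sign; \<open>p\<close> picks one of them for each index.\<close>

locale unit_vectors =
  fixes I :: "'i set" and p :: "'i \<Rightarrow> 'a::{field,finite} vec3"
  assumes two_neq_0: "(2 :: 'a) \<noteq> 0"
    and finite_I: "finite I"
    and qf_p [simp]: "i \<in> I \<Longrightarrow> qf (p i) = 1"
    and ex1_p: "qf v = 1 \<Longrightarrow> \<exists>!i. i \<in> I \<and> (v = p i \<or> v = - p i)"
begin

definition idx :: "'a vec3 \<Rightarrow> 'i" where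
  "idx v = (THE i. i \<in> I \<and> (v = p i \<or> v = - p i))"

lemma idx:
  assumes "qf v = 1"
  shows idx_in [simp]: "idx v \<in> I" and p_idx: "p (idx v) = v \<or> p (idx v) = - v"
proof -
  have "idx v \<in> I \<and> (v = p (idx v) \<or> v = - p (idx v))"
    using theI'[OF ex1_p[OF assms]] unfolding idx_def .
  then show "idx v \<in> I" "p (idx v) = v \<or> p (idx v) = - v" by (metis minus_minus)+
qed

lemma idx_eq: "i \<in> I \<Longrightarrow> v = p i \<or> v = - p i \<Longrightarrow> idx v = i"
  unfolding idx_def by (rule the1_equality[OF ex1_p]) auto

lemma idx_p [simp]: "i \<in> I \<Longrightarrow> idx (p i) = i"
  by (rule idx_eq) auto

lemma idx_uminus [simp]:
  assumes "qf v = 1"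
  shows "idx (- v) = idx v"
  using p_idx[OF assms] by (intro idx_eq idx_in assms) auto

lemma p_eq_iff: "i \<in> I \<Longrightarrow> j \<in> I \<Longrightarrow> p i = p j \<or> p i = - p j \<longleftrightarrow> i = j"
  using idx_eq by (metis idx_p)

lemma p_signed: "i \<in> I \<Longrightarrow> qf v = 1 \<Longrightarrow> idx v = i \<Longrightarrow> v = p i \<or> v = - p i"
  using p_idx[of v] by auto

lemma bf_p_idx [simp]:
  assumes "qf v = 1"
  shows "bf (p (idx v)) u = 0 \<longleftrightarrow> bf v u = 0" "bf u (p (idx v)) = 0 \<longleftrightarrow> bf u v = 0"
    "(bf (p (idx v)) u)\<^sup>2 = (bf v u)\<^sup>2"
  using p_idx[OF assms] by auto

lemma bf_p_self [simp]: "i \<in> I \<Longrightarrow> bf (p i) (p i) = 2"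
  by (simp add: bf_self)

lemma p_neq_0: "i \<in> I \<Longrightarrow> p i \<noteq> 0"
  using qf_p by (metis qf_zero zero_neq_one)

lemma four_eq: "(4 :: 'a) = 2\<^sup>2"
  by simp

lemma four_neq_0: "(4 :: 'a) \<noteq> 0"
  by (rule four_neq_zero[OF two_neq_0])

lemma eq_uminus_self: "(a :: 'a) = - a \<longleftrightarrow> a = 0"
proof
  assume "a = - a"
  then have "2 * a = 0" by (metis add.right_inverse mult_2)
  then show "a = 0" using two_neq_0 by simp
qed simp

lemma two_neq_minus_two: "(2 :: 'a) \<noteq> - 2"
  using eq_uminus_self two_neq_0 by blast

text \<open>Reflections commute with negation, so the sign lost in \<open>idx\<close> is harmless
  and they act on indices as involutions.\<close>

lemma idx_reflect_reflect:
  assumes "i \<in> I" "qf w \<noteq> 0"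
  shows "idx (reflect w (p (idx (reflect w (p i))))) = i"
proof -
  have q: "qf (reflect w (p i)) = 1" using assms by (simp add: qf_reflect)
  have "reflect w (p (idx (reflect w (p i)))) = p i \<or> reflect w (p (idx (reflect w (p i)))) = - p i"
    using p_idx[OF q] reflect_reflect[OF assms(2), of "p i"] by (metis reflect_uminus)
  then show ?thesis by (rule idx_eq[OF assms(1)])
qed

text \<open>Two distinct \<open>u\<close>, \<open>v\<close> with \<open>qf = 1\<close> span a tangent line iff their Gram determinant
  \<open>4 - (bf u v)\<^sup>2\<close> vanishes.\<close>

definition tgt :: "'i \<Rightarrow> 'i \<Rightarrow> bool" where
  "tgt i j \<longleftrightarrow> i \<noteq> j \<and> (bf (p i) (p j))\<^sup>2 = 4"

section \<open>Counting paths of length three modulo 2\<close>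

definition paths :: "'i \<Rightarrow> 'i \<Rightarrow> ('i \<times> 'i) set" where
  "paths i j = {(k, l) \<in> I \<times> I. bf (p i) (p k) = 0 \<and> bf (p k) (p l) = 0 \<and> bf (p l) (p j) = 0}"

text \<open>A path is fixed by the reversal iff \<open>l\<close> is the mirror image of
  \<open>k\<close>, so \<open>k\<close> determines it. Orthogonality of \<open>k\<close> to its own
  mirror image becomes the quadratic condition. The sign of \<open>u\<close> is left free so that
  the value 2 can be avoided.\<close>

lemma odd_card_paths_iff:
  assumes i: "i \<in> I" and j: "j \<in> I" and u: "u = p i \<or> u = - p i" and g: "bf u (p j) \<noteq> 2"
  shows "odd (card (paths i j)) \<longleftrightarrow>
    odd (card {k \<in> I. bf (p k) u = 0 \<and> (bf (p k) (p j))\<^sup>2 = 2 * (2 - bf u (p j))})"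
proof -
  define v where "v = p j"
  define w where "w = u - v"
  let ?S = "{k \<in> I. bf (p k) u = 0 \<and> (bf (p k) v)\<^sup>2 = 2 * (2 - bf u v)}"
  have uv: "qf u = 1" "qf v = 1" "bf u v \<noteq> 2" using u i j g by (auto simp: v_def)
  have w: "qf w \<noteq> 0" "reflect w u = v" "reflect w v = u"
    using reflect_swap[OF uv] by (simp_all add: w_def)
  have qw: "qf w = 2 - bf u v" using uv by (simp add: w_def qf_diff)
  have qr: "qf (reflect w (p k)) = 1" if "k \<in> I" for k using that w by (simp add: qf_reflect)
  have paths: "(k, l) \<in> paths i j \<longleftrightarrow> k \<in> I \<and> l \<in> I \<and>
    bf (p k) u = 0 \<and> bf (p k) (p l) = 0 \<and> bf (p l) v = 0" for k l
    using u by (auto simp: paths_def v_def bf_commute[of "p i"])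
  \<comment> \<open>The reflection is self-adjoint and exchanges \<open>u\<close> and
    \<open>v\<close>.\<close>
  have flip: "bf (reflect w x) v = bf x u" "bf (reflect w x) u = bf x v" for x
    using bf_reflect_left[OF w(1)] w by metis+
  \<comment> \<open>For \<open>p k\<close> orthogonal to \<open>u\<close>, pairing with
    \<open>w = u - v\<close> is minus pairing with \<open>v\<close>.\<close>
  have self: "bf (p k) (reflect w (p k)) = 0 \<longleftrightarrow> (bf (p k) v)\<^sup>2 = 2 * (2 - bf u v)"
    if "k \<in> I" "bf (p k) u = 0" for k
  proof -
    have "bf (p k) (reflect w (p k)) = 2 - (bf (p k) v)\<^sup>2 / qf w"
      using that by (simp add: reflect_def w_def power2_eq_square)
    then show ?thesis using w(1) unfolding qw by (auto simp: divide_simps)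
  qed
  \<comment> \<open>The components trade places because the mirror image of \<open>l\<close>, not of
    \<open>k\<close>, is orthogonal to \<open>u\<close>.\<close>
  define f where "f = (\<lambda>(k, l). (idx (reflect w (p l)), idx (reflect w (p k))))"
  have "even (card (paths i j)) \<longleftrightarrow> even (card {x \<in> paths i j. f x = x})"
  proof (rule even_card_involution)
    have "paths i j \<subseteq> I \<times> I" by (auto simp: paths_def)
    then show "finite (paths i j)" using finite_I by (simp add: finite_subset)
    fix x assume x: "x \<in> paths i j"
    obtain k l where kl: "x = (k, l)" by (cases x)
    then have I: "k \<in> I" "l \<in> I" using x paths by auto
    show "f x \<in> paths i j"
      using x I w unfolding kl by (simp add: f_def paths qr flip bf_reflect bf_commute[of "p l"])
    show "f (f x) = x" using I w unfolding kl by (simp add: f_def idx_reflect_reflect)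
  qed
  moreover have "{x \<in> paths i j. f x = x} = (\<lambda>k. (k, idx (reflect w (p k)))) ` ?S"
  proof (intro equalityI subsetI)
    fix x assume "x \<in> {x \<in> paths i j. f x = x}"
    then obtain k l where kl: "x = (k, l)" "(k, l) \<in> paths i j" "l = idx (reflect w (p k))"
      by (cases x) (auto simp: f_def)
    have I: "k \<in> I" "bf (p k) u = 0" "bf (p k) (reflect w (p k)) = 0"
      using kl(2) unfolding paths kl(3) by (auto simp: qr)
    then have "k \<in> ?S" using self by auto
    then show "x \<in> (\<lambda>k. (k, idx (reflect w (p k)))) ` ?S" using kl by auto
  next
    fix x assume "x \<in> (\<lambda>k. (k, idx (reflect w (p k)))) ` ?S"
    then obtain k where k: "k \<in> I" "bf (p k) u = 0" "bf (p k) (reflect w (p k)) = 0"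
      "x = (k, idx (reflect w (p k)))" using self by auto
    then show "x \<in> {x \<in> paths i j. f x = x}"
      using w by (simp add: f_def paths qr flip idx_reflect_reflect)
  qed
  moreover have "card ((\<lambda>k. (k, idx (reflect w (p k)))) ` ?S) = card ?S"
    by (intro card_image inj_onI) auto
  ultimately show ?thesis by (simp add: v_def)
qed

text \<open>The squared condition admits the values \<open>h\<close> and \<open>- h\<close>,
  attained by \<open>x\<close> and \<open>- x\<close>, which share one index.\<close>

lemma card_ex1_index:
  assumes "\<exists>!x. bf x u = 0 \<and> bf x w = h \<and> qf x = 1" and h: "h \<noteq> 0"
  shows "card {k \<in> I. bf (p k) u = 0 \<and> (bf (p k) w)\<^sup>2 = h\<^sup>2} = 1"
proof -
  obtain x where x: "bf x u = 0" "bf x w = h" "qf x = 1"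
    and uniq: "\<And>y. bf y u = 0 \<Longrightarrow> bf y w = h \<Longrightarrow> qf y = 1 \<Longrightarrow> y = x" using assms(1) by blast
  have "{k \<in> I. bf (p k) u = 0 \<and> (bf (p k) w)\<^sup>2 = h\<^sup>2} = {idx x}"
  proof (intro equalityI subsetI)
    fix k assume "k \<in> {k \<in> I. bf (p k) u = 0 \<and> (bf (p k) w)\<^sup>2 = h\<^sup>2}"
    then have k: "k \<in> I" "bf (p k) u = 0" "bf (p k) w = h \<or> bf (p k) w = - h"
      by (auto simp: power2_eq_iff)
    then have "p k = x \<or> - p k = x" using uniq[of "p k"] uniq[of "- p k"] by auto
    then have "idx x = k" using k(1) by (intro idx_eq) auto
    then show "k \<in> {idx x}" by simp
  qed (use x in simp)
  then show ?thesis by simp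
qed

lemma odd_card_paths:
  assumes i: "i \<in> I" and j: "j \<in> I"
  shows "odd (card (paths i j)) \<longleftrightarrow>
    bf (p i) (p j) = 0 \<or> (\<exists>r :: 'a. r\<^sup>2 = 2) \<and> tgt i j"
proof -
  define v where "v = p j"
  \<comment> \<open>The sign change excludes \<open>g = 2\<close>, so that the reflection in
    \<open>u - v\<close> exists.\<close>
  define u where "u = (if bf (p i) v = 2 then - p i else p i)"
  define g where "g = bf u v"
  have u: "u = p i \<or> u = - p i" and uv: "qf u = 1" "qf v = 1" and g2: "g \<noteq> 2"
    using i j two_neq_minus_two by (auto simp: u_def v_def g_def)
  have g0: "g = 0 \<longleftrightarrow> bf (p i) (p j) = 0" and gs: "g\<^sup>2 = (bf (p i) (p j))\<^sup>2"
    using u by (auto simp: g_def v_def)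
  have g4: "g\<^sup>2 = 4 \<longleftrightarrow> g = - 2" unfolding four_eq power2_eq_iff using g2 by simp
  have g0': "g \<noteq> - 2" if "g = 0" using that two_neq_0 by simp
  define S where "S = {k \<in> I. bf (p k) u = 0 \<and> (bf (p k) v)\<^sup>2 = 2 * (2 - g)}"
  have odd_S: "odd (card (paths i j)) \<longleftrightarrow> odd (card S)"
    using odd_card_paths_iff[OF i j u] g2 by (simp add: S_def g_def v_def)
  show ?thesis
  proof (cases "g = - 2")
    case True
    \<comment> \<open>On vectors orthogonal to \<open>u\<close>, pairing with \<open>v\<close>
      equals pairing with \<open>u + v\<close>. For \<open>g = - 2\<close> this vector is isotropic
      and orthogonal to \<open>u\<close>, and \<open>2 * (2 - g)\<close> is 8.\<close>
    have S: "S = {k \<in> I. bf (p k) u = 0 \<and> (bf (p k) (u + v))\<^sup>2 = 8}"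
      unfolding S_def True by auto
    have "8 = 2 * 2 * (2 :: 'a)" by simp
    then have eight: "(8 :: 'a) \<noteq> 0" using two_neq_0 by (metis mult_eq_0_iff)
    have ij: "u + v = 0 \<longleftrightarrow> i = j"
    proof
      assume "u + v = 0"
      then have "v = - u" by (simp add: eq_neg_iff_add_eq_0 add.commute)
      then have "p j = p i \<or> p j = - p i" using u by (auto simp: v_def)
      then show "i = j" using p_eq_iff[OF j i] by simp
    next
      assume "i = j"
      then show "u + v = 0" using i by (simp add: u_def v_def)
    qed
    have "odd (card S) \<longleftrightarrow> (\<exists>r :: 'a. r\<^sup>2 = 2) \<and> i \<noteq> j"
    proof (cases "(\<exists>r :: 'a. r\<^sup>2 = 2) \<and> i \<noteq> j")
      case True
      then obtain r :: 'a where r: "r\<^sup>2 = 2" by auto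
      \<comment> \<open>A square root of 8 serves as the height \<open>h\<close> of the isotropic
        line.\<close>
      have h: "(2 * r)\<^sup>2 = 8" "2 * r \<noteq> 0" using r two_neq_0 by (auto simp: power_mult_distrib)
      have "\<exists>!x. bf x u = 0 \<and> bf x (u + v) = 2 * r \<and> qf x = 1"
      proof (rule ex1_on_isotropic_line[OF two_neq_0 uv(1)])
        show "qf (u + v) = 0" "bf u (u + v) = 0" "u + v \<noteq> 0"
          using uv \<open>g = - 2\<close> ij True by (simp_all add: qf_add bf_self g_def)
      qed (fact h)
      from card_ex1_index[OF this h(2)] have "card S = 1" unfolding S h(1) .
      then show ?thesis using True by simp
    next
      case False
      \<comment> \<open>If \<open>i = j\<close>, then \<open>u + v = 0\<close> and the condition
        reads \<open>0 = 8\<close>; otherwise half a square root of 8 would be one of 2.\<close>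
      have "S = {}"
      proof (cases "i = j")
        case True
        then show ?thesis using ij eight by (auto simp: S)
      next
        case False
        then have no: "\<nexists>r :: 'a. r\<^sup>2 = 2" using \<open>\<not> (_ \<and> _)\<close> by blast
        have "x\<^sup>2 \<noteq> 8" for x :: 'a
        proof
          assume "x\<^sup>2 = 8"
          then have "(x / 2)\<^sup>2 = 4 * 2 / 4" by (simp add: power_divide)
          also have "\<dots> = 2" using four_neq_0 by (rule nonzero_mult_div_cancel_left)
          finally have "(x / 2)\<^sup>2 = 2" .
          then show False using no by blast
        qed
        then show ?thesis by (auto simp: S)
      qed
      then show ?thesis using False by simp
    qed
    then show ?thesis using odd_S g0 g0' g4 gs True by (auto simp: tgt_def)
  next
    case False
    \<comment> \<open>Twice the component of \<open>v\<close> orthogonal to \<open>u\<close>. On the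
      vectors orthogonal to \<open>u\<close>, its reflection negates the pairing with
      \<open>v\<close>, hence it preserves \<open>S\<close>.\<close>
    define w where "w = scl 2 v - scl g u"
    have "4 - g\<^sup>2 = (2 - g) * (2 + g)" by (simp add: power2_eq_square algebra_simps)
    moreover have "2 - g \<noteq> 0" "2 + g \<noteq> 0"
      using False g2 by (auto simp: eq_neg_iff_add_eq_0 add.commute)
    ultimately have d: "4 - g\<^sup>2 = (2 - g) * (2 + g)" "4 - g\<^sup>2 \<noteq> 0" by auto
    have w: "qf w = 4 - g\<^sup>2" "bf w u = 0" "bf w v = 4 - g\<^sup>2"
      using uv by (simp_all add: w_def qf_diff bf_self g_def bf_commute[of v u] power2_eq_square)
    have qw: "qf w \<noteq> 0" using w d by simp
    have bw: "bf x w = 2 * bf x v" if "bf x u = 0" for x using that by (simp add: w_def)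
    have r: "bf (reflect w x) u = 0" "bf (reflect w x) v = - bf x v" if "bf x u = 0" for x
      using that w qw by (simp_all add: reflect_def bw)
    have qr: "qf (reflect w (p k)) = 1" if "k \<in> I" for k using that qw by (simp add: qf_reflect)
    have "even (card S) \<longleftrightarrow> even (card {k \<in> S. idx (reflect w (p k)) = k})"
    proof (rule even_card_involution)
      show "finite S" using finite_I by (simp add: S_def)
      show "idx (reflect w (p k)) \<in> S" if "k \<in> S" for k
        using that qw by (simp add: S_def qr r)
      show "idx (reflect w (p (idx (reflect w (p k))))) = k" if "k \<in> S" for k
        using that qw by (simp add: S_def idx_reflect_reflect)
    qed
    moreover have "{k \<in> S. idx (reflect w (p k)) = k} = (if g = 0 then {j} else {})"
    proof -
      have "g = 0 \<and> k = j" if k: "k \<in> S" "idx (reflect w (p k)) = k" for k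
      proof -
        define x where "x = p k"
        have x: "k \<in> I" "bf x u = 0" "(bf x v)\<^sup>2 = 2 * (2 - g)" "qf x = 1"
          using k(1) by (auto simp: S_def x_def)
        have "2 * (2 - g) \<noteq> 0" using two_neq_0 \<open>2 - g \<noteq> 0\<close> by (rule no_zero_divisors)
        \<comment> \<open>As the pairing with \<open>v\<close> is nonzero and changes sign, a fixed
          index must have its vector negated, which makes \<open>x\<close> a multiple of
          \<open>w\<close>.\<close>
        then have xv: "bf x v \<noteq> 0" unfolding x(3)[symmetric] by auto
        have "reflect w x = x \<or> reflect w x = - x"
          using p_signed[OF x(1), of "reflect w x"] qr[OF x(1)] k(2) by (auto simp: x_def)
        moreover have "reflect w x \<noteq> x"
        proof
          assume "reflect w x = x"
          then show False using r(2)[OF x(2)] xv eq_uminus_self by metis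
        qed
        ultimately have "x = scl (bf x w / 2 / qf w) w"
          using reflect_eq_uminus[OF two_neq_0] by blast
        then have xw: "x = scl (bf x v / (4 - g\<^sup>2)) w"
          using two_neq_0 unfolding bw[OF x(2)] w(1) by simp
        \<comment> \<open>Comparing norms yields \<open>1 = 2 / (2 + g)\<close>. So
          \<open>g = 0\<close>, and then \<open>w = scl 2 v\<close> forces \<open>x\<close> to be
          \<open>v\<close> up to sign.\<close>
        then have "1 = (bf x v / (4 - g\<^sup>2))\<^sup>2 * (4 - g\<^sup>2)" using x(4) w by (metis qf_scl)
        also have "\<dots> = (bf x v)\<^sup>2 / (4 - g\<^sup>2)"
          using d(2) by (simp add: power2_eq_square)
        also have "\<dots> = (2 - g) * 2 / ((2 - g) * (2 + g))"
          by (simp only: x(3) d(1) mult.commute[of 2 "2 - g"])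
        also have "\<dots> = 2 / (2 + g)" using \<open>2 - g \<noteq> 0\<close> by (rule mult_divide_mult_cancel_left)
        finally have "2 + g = 2" using \<open>2 + g \<noteq> 0\<close> by (simp add: divide_simps)
        then have g: "g = 0" by simp
        have "(bf x v)\<^sup>2 = 2\<^sup>2" using x(3) g by simp
        then have "bf x v = 2 \<or> bf x v = - 2" by (simp only: power2_eq_iff)
        moreover have "x = scl (bf x v / 2) v"
        proof -
          have c: "bf x v / 4 * 2 = bf x v / 2"
            using four_neq_0 two_neq_0 by (simp add: divide_simps)
          have "x = scl (bf x v / 4 * 2) v" using xw g by (simp add: w_def)
          then show ?thesis unfolding c .
        qed
        ultimately have "x = v \<or> x = - v" using two_neq_0 by auto
        then have "k = j" using p_eq_iff[OF x(1) j] by (simp add: x_def v_def)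
        then show ?thesis using g by simp
      qed
      \<comment> \<open>Conversely, for \<open>g = 0\<close> the reflection simply negates
        \<open>v\<close>, and \<open>(bf v v)\<^sup>2 = 4\<close> is the required value.\<close>
      moreover have "j \<in> S" "idx (reflect w (p j)) = j" if "g = 0"
      proof -
        have uv0: "bf v u = 0" using that by (simp add: g_def bf_commute)
        show "j \<in> S" using that j uv0 by (simp add: S_def v_def)
        have "bf v w / qf w = 1" using w d by (simp add: bf_commute)
        then have "reflect w v = v - scl 2 v" using that by (simp add: reflect_def w_def)
        also have "\<dots> = - v" using scl_diff_left[of 1 2 v] by simp
        finally show "idx (reflect w (p j)) = j" using j by (simp add: v_def)
      qed
      ultimately show ?thesis by auto
    qed
    ultimately have "odd (card S) \<longleftrightarrow> g = 0" by simp
    then show ?thesis using odd_S g0 g4 gs False by (auto simp: tgt_def)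
  qed
qed

section \<open>Tangency followed by orthogonality, modulo 2\<close>

text \<open>If \<open>g\<^sup>2 = 4\<close> and \<open>i\<close> differs from \<open>j\<close>, an
  isotropic line contributes exactly one \<open>k\<close>. If \<open>g\<^sup>2\<close> is not 4, a
  reflection preserving \<open>v\<close> acts on the \<open>k\<close> without fixed points.\<close>

lemma odd_card_tgt_orthogonal:
  assumes i: "i \<in> I" and j: "j \<in> I"
  shows "odd (card {k \<in> I. tgt i k \<and> bf (p k) (p j) = 0}) \<longleftrightarrow> tgt i j"
proof -
  define u where "u = p i"
  define v where "v = p j"
  define g where "g = bf u v"
  have uv: "qf u = 1" "qf v = 1" using i j by (simp_all add: u_def v_def)
  define S where "S = {k \<in> I. tgt i k \<and> bf (p k) v = 0}"
  show ?thesis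
  proof (cases "g\<^sup>2 = 4")
    case True
    show ?thesis
    proof (cases "i = j")
      case True
      have S: "{k \<in> I. tgt i k \<and> bf (p k) (p j) = 0} = {}"
        using j by (auto simp: S_def tgt_def bf_commute[of "p j"] True four_neq_0[symmetric])
      show ?thesis unfolding S using True by (simp add: tgt_def)
    next
      case False
      obtain s where s: "s = v \<or> s = - v" "bf u s = 2"
      proof -
        have "g = 2 \<or> g = - 2" using True unfolding four_eq by (simp only: power2_eq_iff)
        then show ?thesis using that[of v] that[of "- v"] by (auto simp: g_def)
      qed
      have us: "qf s = 1" "u \<noteq> s"
        using s uv False p_eq_iff[OF i j] by (auto simp: u_def v_def)
      \<comment> \<open>With \<open>bf u s = 2\<close>, the vector \<open>u - s\<close> is isotropic
        and orthogonal to \<open>s\<close>. For \<open>x\<close> orthogonal to \<open>s\<close>, its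
        pairing with \<open>x\<close> is \<open>bf x u\<close>, so the tangency condition is a
        squared height of 4.\<close>
      have "\<exists>!x. bf x s = 0 \<and> bf x (u - s) = 2 \<and> qf x = 1"
      proof (rule ex1_on_isotropic_line[OF two_neq_0 us(1)])
        show "qf (u - s) = 0" "bf s (u - s) = 0" "u - s \<noteq> 0"
          using us uv s(2) by (simp_all add: qf_diff bf_self bf_commute[of s])
      qed (fact two_neq_0)
      from card_ex1_index[OF this two_neq_0]
      have "card {k \<in> I. bf (p k) s = 0 \<and> (bf (p k) (u - s))\<^sup>2 = 2\<^sup>2} = 1" .
      moreover have "{k \<in> I. bf (p k) s = 0 \<and> (bf (p k) (u - s))\<^sup>2 = 2\<^sup>2} = S"
      proof (rule Set.set_eqI)
        fix k
        have i: "bf u s \<noteq> 0" using s two_neq_0 by simp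
        have v: "bf (p k) v = 0 \<longleftrightarrow> bf (p k) s = 0" using s(1) by auto
        show "k \<in> {k \<in> I. bf (p k) s = 0 \<and> (bf (p k) (u - s))\<^sup>2 = 2\<^sup>2} \<longleftrightarrow> k \<in> S"
          unfolding S_def tgt_def using i v
          by (cases "bf (p k) s = 0"; cases "i = k") (simp_all add: u_def bf_commute[of "p i"])
      qed
      ultimately have "odd (card S)" by simp
      then show ?thesis using False True by (simp add: S_def tgt_def v_def u_def g_def)
    qed
  next
    case False
    \<comment> \<open>Twice the component of \<open>u\<close> orthogonal to \<open>v\<close>: the
      roles of the two endpoints are exchanged compared with \<open>odd_card_paths\<close>.\<close>
    define w where "w = scl 2 u - scl g v"
    have d: "4 - g\<^sup>2 \<noteq> 0" using False by auto
    have w: "qf w = 4 - g\<^sup>2" "bf w v = 0" "bf w u = 4 - g\<^sup>2"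
      using uv by (simp_all add: w_def qf_diff bf_self g_def bf_commute[of v u] power2_eq_square)
    have qw: "qf w \<noteq> 0" using w d by simp
    have bw: "bf x w = 2 * bf x u" if "bf x v = 0" for x using that by (simp add: w_def)
    have r: "bf (reflect w x) v = 0" "bf (reflect w x) u = - bf x u" if "bf x v = 0" for x
      using that w qw by (simp_all add: reflect_def bw)
    have qr: "qf (reflect w (p k)) = 1" if "k \<in> I" for k using that qw by (simp add: qf_reflect)
    have Sk: "k \<in> S \<longleftrightarrow> k \<in> I \<and> k \<noteq> i \<and> bf (p k) v = 0 \<and> (bf (p k) u)\<^sup>2 = 4" for k
      by (auto simp: S_def tgt_def u_def bf_commute[of "p i"])
    have reflect_u: "idx (reflect w u) = i" if "bf u v = 0"
    proof -
      have "bf u w / qf w = 1" using w d by (simp add: bf_commute)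
      then have "reflect w u = u - scl 2 u" using that by (simp add: reflect_def w_def g_def)
      also have "\<dots> = - u" using scl_diff_left[of 1 2 u] by simp
      finally show ?thesis using i by (simp add: u_def)
    qed
    have "even (card S) \<longleftrightarrow> even (card {k \<in> S. idx (reflect w (p k)) = k})"
    proof (rule even_card_involution)
      show "finite S" using finite_I by (simp add: S_def)
      show "idx (reflect w (p k)) \<in> S" if k: "k \<in> S" for k
      proof -
        have I: "k \<in> I" "bf (p k) v = 0" using k Sk by auto
        \<comment> \<open>If \<open>k\<close> were sent to \<open>i\<close>, then \<open>u\<close>
          would be orthogonal to \<open>v\<close>, so \<open>i\<close> would be fixed and
          \<open>k = i\<close>, which \<open>tgt\<close> forbids.\<close>
        have "idx (reflect w (p k)) \<noteq> i"
        proof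
          assume e: "idx (reflect w (p k)) = i"
          then have "bf u v = 0" using bf_p_idx(1)[OF qr[OF I(1)], of v] r(1)[OF I(2)] by (simp add: u_def)
          moreover have "idx (reflect w (p i)) = k" using idx_reflect_reflect[OF I(1) qw] e by simp
          ultimately show False using reflect_u k Sk by (simp add: u_def)
        qed
        then show ?thesis using k qw by (simp add: Sk qr r)
      qed
      show "idx (reflect w (p (idx (reflect w (p k))))) = k" if "k \<in> S" for k
        using that qw by (simp add: S_def idx_reflect_reflect)
    qed
    moreover have "{k \<in> S. idx (reflect w (p k)) = k} = {}"
    proof -
      have False if k: "k \<in> S" "idx (reflect w (p k)) = k" for k
      proof -
        define x where "x = p k"
        have x: "k \<in> I" "bf x v = 0" "(bf x u)\<^sup>2 = 4" "qf x = 1" "k \<noteq> i"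
          using k(1) Sk by (auto simp: x_def)
        have xu: "bf x u \<noteq> 0" using x(3) four_neq_0 by (metis zero_power2)
        have "reflect w x = x \<or> reflect w x = - x"
          using p_signed[OF x(1), of "reflect w x"] qr[OF x(1)] k(2) by (auto simp: x_def)
        moreover have "reflect w x \<noteq> x"
        proof
          assume "reflect w x = x"
          then show False using r(2)[OF x(2)] xu eq_uminus_self by metis
        qed
        ultimately have "x = scl (bf x w / 2 / qf w) w"
          using reflect_eq_uminus[OF two_neq_0] by blast
        then have xw: "x = scl (bf x u / (4 - g\<^sup>2)) w"
          using two_neq_0 unfolding bw[OF x(2)] w(1) by simp
        \<comment> \<open>Comparing norms yields \<open>4 - g\<^sup>2 = 4\<close>. So
          \<open>w = scl 2 u\<close>, and a fixed index could only be the excluded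
          \<open>i\<close>.\<close>
        then have "1 = (bf x u / (4 - g\<^sup>2))\<^sup>2 * (4 - g\<^sup>2)" using x(4) w by (metis qf_scl)
        also have "\<dots> = (bf x u)\<^sup>2 / (4 - g\<^sup>2)"
          using d by (simp add: power2_eq_square)
        also have "\<dots> = 4 / (4 - g\<^sup>2)" by (simp only: x(3))
        finally have "4 - g\<^sup>2 = 4" using d by (simp add: divide_simps)
        then have g: "g = 0" by simp
        have "bf x u = 2 \<or> bf x u = - 2" using x(3) unfolding four_eq by (simp only: power2_eq_iff)
        moreover have "x = scl (bf x u / 2) u"
        proof -
          have c: "bf x u / 4 * 2 = bf x u / 2"
            using four_neq_0 two_neq_0 by (simp add: divide_simps)
          have "x = scl (bf x u / 4 * 2) u" using xw g by (simp add: w_def)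
          then show ?thesis unfolding c .
        qed
        ultimately have "x = u \<or> x = - u" using two_neq_0 by auto
        then have "k = i" using p_eq_iff[OF x(1) i] by (simp add: x_def u_def)
        then show False using x(5) by simp
      qed
      then show ?thesis by auto
    qed
    ultimately have "even (card S)" by simp
    then show ?thesis using False by (simp add: S_def tgt_def u_def v_def g_def)
  qed
qed

end

section \<open>External points\<close>

lemma proportional_refl: "v \<noteq> 0 \<Longrightarrow> proportional v v"
  by (cases v) (auto simp: proportional_def zero_prod_def intro!: exI[of _ 1])

lemma proportional_iff_scl:
  "proportional u v \<longleftrightarrow> u \<noteq> 0 \<and> v \<noteq> 0 \<and> (\<exists>c. c \<noteq> 0 \<and> v = scl c u)"
  by (cases u; cases v) (auto simp: proportional_def zero_prod_def)

lemma abs_point_eq_iff: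
  "u \<noteq> 0 \<Longrightarrow> v \<noteq> 0 \<Longrightarrow> abs_point u = abs_point v \<longleftrightarrow> (\<exists>c. c \<noteq> 0 \<and> v = scl c u)"
  using Quotient3_rel[OF Quotient3_point, of u v] proportional_refl[of u] proportional_refl[of v]
  by (simp add: proportional_iff_scl)

lemma abs_line_eq_iff:
  "u \<noteq> 0 \<Longrightarrow> v \<noteq> 0 \<Longrightarrow> abs_line u = abs_line v \<longleftrightarrow> (\<exists>c. c \<noteq> 0 \<and> v = scl c u)"
  using Quotient3_rel[OF Quotient3_line, of u v] proportional_refl[of u] proportional_refl[of v]
  by (simp add: proportional_iff_scl)

lemma point_cases:
  obtains v where "v \<noteq> 0" "X = abs_point v"
proof
  show "rep_point X \<noteq> 0"
    using Quotient3_rep_reflp[OF Quotient3_point, of X] by (simp add: proportional_iff_scl)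
  show "X = abs_point (rep_point X)"
    by (rule Quotient3_abs_rep[OF Quotient3_point, symmetric])
qed

lemma line_cases:
  obtains v where "v \<noteq> 0" "l = abs_line v"
proof
  show "rep_line l \<noteq> 0"
    using Quotient3_rep_reflp[OF Quotient3_line, of l] by (simp add: proportional_iff_scl)
  show "l = abs_line (rep_line l)"
    by (rule Quotient3_abs_rep[OF Quotient3_line, symmetric])
qed

lemma lies_on_abs:
  "u \<noteq> 0 \<Longrightarrow> v \<noteq> 0 \<Longrightarrow> lies_on (abs_point u) (abs_line v) \<longleftrightarrow>
    (case u of (a0, a1, a2) \<Rightarrow> case v of (b0, b1, b2) \<Rightarrow> a0 * b0 + a1 * b1 + a2 * b2 = 0)"
  using lies_on.abs_eq[of u v] proportional_refl[of u] proportional_refl[of v]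
  by (simp add: eq_onp_def split: prod.splits)

text \<open>Roots of \<open>a + b t + c t\<^sup>2\<close> on the projective line, with \<open>None\<close> as the point at infinity.\<close>

fun proj_root :: "'a::field vec3 \<Rightarrow> 'a option \<Rightarrow> bool" where
  "proj_root (a, b, c) None \<longleftrightarrow> c = 0"
| "proj_root (a, b, c) (Some t) \<longleftrightarrow> a + b * t + c * t\<^sup>2 = 0"

text \<open>For nonzero \<open>c\<close>, completing the square matches the roots with the square
  roots of the discriminant. For \<open>c = 0\<close> the discriminant is \<open>b\<^sup>2\<close>,
  infinity is a root, and a finite one exists iff \<open>b\<close> is nonzero.\<close>

lemma card_roots:
  fixes a b c :: "'a::{field,finite}"
  assumes two: "(2 :: 'a) \<noteq> 0" and nz: "(a, b, c) \<noteq> 0"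
  shows "card {s. proj_root (a, b, c) s} =
    (if b\<^sup>2 - 4 * a * c = 0 then 1 else if \<exists>e. b\<^sup>2 - 4 * a * c = e\<^sup>2 then 2 else 0)"
proof (cases "c = 0")
  case True
  have "{s. proj_root (a, b, c) s} = (if b = 0 then {None} else {None, Some (- a / b)})"
  proof (rule Set.set_eqI)
    fix s
    show "s \<in> {s. proj_root (a, b, c) s} \<longleftrightarrow> s \<in> (if b = 0 then {None} else {None, Some (- a / b)})"
      using True nz by (cases s) (auto simp: zero_prod_def field_simps eq_neg_iff_add_eq_0)
  qed
  then show ?thesis using True by auto
next
  case False
  have four: "(4 :: 'a) \<noteq> 0" by (rule four_neq_zero[OF two])
  have sq: "(2 * c * t + b)\<^sup>2 - (b\<^sup>2 - 4 * a * c) = 4 * c * (a + b * t + c * t\<^sup>2)" for t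
    by (simp add: power2_eq_square algebra_simps)
  have root_iff: "a + b * t + c * t\<^sup>2 = 0 \<longleftrightarrow> (2 * c * t + b)\<^sup>2 = b\<^sup>2 - 4 * a * c" for t
    using sq[of t] four False by auto
  have "bij_betw (\<lambda>w. Some ((w - b) / (2 * c))) {w. w\<^sup>2 = b\<^sup>2 - 4 * a * c} {s. proj_root (a, b, c) s}"
  proof (rule bij_betw_imageI)
    show "inj_on (\<lambda>w. Some ((w - b) / (2 * c))) {w. w\<^sup>2 = b\<^sup>2 - 4 * a * c}"
      using False two by (auto simp: inj_on_def)
    show "(\<lambda>w. Some ((w - b) / (2 * c))) ` {w. w\<^sup>2 = b\<^sup>2 - 4 * a * c} = {s. proj_root (a, b, c) s}"
    proof (intro equalityI subsetI)
      fix s assume "s \<in> (\<lambda>w. Some ((w - b) / (2 * c))) ` {w. w\<^sup>2 = b\<^sup>2 - 4 * a * c}"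
      then obtain w t where w: "w\<^sup>2 = b\<^sup>2 - 4 * a * c" "s = Some t" "t = (w - b) / (2 * c)" by auto
      then have "2 * c * t + b = w" using False two by simp
      then show "s \<in> {s. proj_root (a, b, c) s}" using w(1,2) root_iff[of t] by simp
    next
      fix s assume "s \<in> {s. proj_root (a, b, c) s}"
      then obtain t where t: "s = Some t" "(2 * c * t + b)\<^sup>2 = b\<^sup>2 - 4 * a * c"
        using False root_iff by (cases s) auto
      have "s = Some ((2 * c * t + b - b) / (2 * c))" using False two t(1) by simp
      then show "s \<in> (\<lambda>w. Some ((w - b) / (2 * c))) ` {w. w\<^sup>2 = b\<^sup>2 - 4 * a * c}"
        using t(2) by blast
    qed
  qed
  then have "card {w. w\<^sup>2 = b\<^sup>2 - 4 * a * c} = card {s. proj_root (a, b, c) s}"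
    by (rule bij_betw_same_card)
  then show ?thesis unfolding card_square_roots[OF two] by (rule sym)
qed

section \<open>Conic points and tangent lines, parametrized by the projective line\<close>

fun conic_pt :: "'a::field option \<Rightarrow> 'a point" where
  "conic_pt None = abs_point (0, 0, 1)"
| "conic_pt (Some t) = abs_point (1, t, t\<^sup>2)"

text \<open>The polar of \<open>conic_pt s\<close>, which is the tangent at that point.\<close>

fun tangent_ln :: "'a::field option \<Rightarrow> 'a line" where
  "tangent_ln None = abs_line (1, 0, 0)"
| "tangent_ln (Some t) = abs_line (t\<^sup>2, - 2 * t, 1)"

lemma inj_conic_pt: "inj conic_pt"
proof (rule injI)
  fix s t :: "'a option" assume "conic_pt s = conic_pt t"
  then show "s = t"
    by (cases s; cases t) (auto simp: abs_point_eq_iff zero_prod_def)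
qed

lemma conic_eq: "conic = range conic_pt"
proof -
  have "range conic_pt = insert (conic_pt None) (range (\<lambda>t. conic_pt (Some t)))"
    by (simp add: UNIV_option_conv image_image)
  then show ?thesis by (auto simp: conic_def)
qed

lemma lies_on_conic_pt:
  "v \<noteq> 0 \<Longrightarrow> lies_on (conic_pt s) (abs_line v) \<longleftrightarrow> proj_root v s"
  by (cases s; cases v) (simp_all add: lies_on_abs zero_prod_def mult.commute)

text \<open>The parameters of the conic points on the line are the roots of
  \<open>a + b t + c t\<^sup>2\<close>; one root means discriminant 0.\<close>

lemma tangent_abs_line:
  fixes a b c :: "'a::{field,finite}"
  assumes two: "(2 :: 'a) \<noteq> 0" and nz: "(a, b, c) \<noteq> 0"
  shows "tangent (abs_line (a, b, c)) \<longleftrightarrow> b\<^sup>2 = 4 * a * c"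
proof -
  have "{X \<in> conic. lies_on X (abs_line (a, b, c))} = conic_pt ` {s. proj_root (a, b, c) s}"
    using nz by (auto simp: conic_eq lies_on_conic_pt)
  then have "card {X \<in> conic. lies_on X (abs_line (a, b, c))} = card {s. proj_root (a, b, c) s}"
    by (simp add: card_image inj_on_subset[OF inj_conic_pt])
  then show ?thesis unfolding tangent_def card_roots[OF two nz] by auto
qed

lemma tangent_eq:
  assumes two: "(2 :: 'a::{field,finite}) \<noteq> 0"
  shows "{l :: 'a line. tangent l} = range tangent_ln"
proof (intro equalityI subsetI)
  fix l :: "'a line" assume "l \<in> {l. tangent l}"
  moreover obtain v where v: "v \<noteq> 0" "l = abs_line v" using line_cases .
  moreover obtain a b c where abc: "v = (a, b, c)" by (cases v) auto
  ultimately have d: "b\<^sup>2 = 4 * a * c" using tangent_abs_line[OF two] by auto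
  show "l \<in> range tangent_ln"
  proof (cases "c = 0")
    case True
    then have "b = 0" "a \<noteq> 0" using d v by (auto simp: abc zero_prod_def)
    then have "l = tangent_ln None" using True v
      by (simp add: abc) (subst abs_line_eq_iff, auto simp: zero_prod_def intro!: exI[of _ "1 / a"])
    then show ?thesis by blast
  next
    case False
    \<comment> \<open>Scaling the last coordinate to 1 turns the middle one into
      \<open>b / c\<close>, to be matched with \<open>- 2 * t\<close>.\<close>
    have "(- b / (2 * c))\<^sup>2 = 4 * a * c / (4 * c\<^sup>2)"
      by (simp add: power_divide power_mult_distrib d)
    also have "\<dots> = a / c"
      using False four_neq_zero[OF two] by (simp add: power2_eq_square)
    finally have t: "(- b / (2 * c))\<^sup>2 = a / c" .
    then have "l = tangent_ln (Some (- b / (2 * c)))"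
      using False v two unfolding tangent_ln.simps t
      by (simp add: abc) (subst abs_line_eq_iff, auto simp: zero_prod_def intro!: exI[of _ "1 / c"])
    then show ?thesis by blast
  qed
next
  fix l :: "'a line" assume "l \<in> range tangent_ln"
  then obtain s where "l = tangent_ln s" by auto
  then show "l \<in> {l. tangent l}"
    by (cases s) (simp_all add: tangent_abs_line[OF two] zero_prod_def power_mult_distrib)
qed

lemma inj_tangent_ln:
  assumes two: "(2 :: 'a::field) \<noteq> 0"
  shows "inj (tangent_ln :: 'a option \<Rightarrow> 'a line)"
proof (rule injI)
  fix s t :: "'a option" assume "tangent_ln s = tangent_ln t"
  then show "s = t"
    using two by (cases s; cases t) (auto simp: abs_line_eq_iff zero_prod_def)
qed

text \<open>The tangents through the point correspond to the roots of
  \<open>z - 2 y t + x t\<^sup>2\<close>, whose discriminant is \<open>4 * qf v\<close>.\<close>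

lemma external_abs_point:
  fixes v :: "'a::{field,finite} vec3"
  assumes two: "(2 :: 'a) \<noteq> 0" and nz: "v \<noteq> 0"
  shows "external (abs_point v) \<longleftrightarrow> qf v \<noteq> 0 \<and> (\<exists>e. qf v = e\<^sup>2)"
proof -
  obtain x y z where v: "v = (x, y, z)" by (cases v) auto
  have nz': "(z, - 2 * y, x) \<noteq> 0" using nz two by (auto simp: v zero_prod_def)
  have "lies_on (abs_point v) (tangent_ln s) \<longleftrightarrow> proj_root (z, - 2 * y, x) s" for s
    using nz by (cases s) (simp_all add: v lies_on_abs zero_prod_def algebra_simps)
  moreover have "tangent l \<longleftrightarrow> l \<in> range tangent_ln" for l :: "'a line"
    using tangent_eq[OF two] by auto
  ultimately have "{l. tangent l \<and> lies_on (abs_point v) l} = tangent_ln ` {s. proj_root (z, - 2 * y, x) s}"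
    by auto
  then have card: "card {l. tangent l \<and> lies_on (abs_point v) l} = card {s. proj_root (z, - 2 * y, x) s}"
    by (simp add: card_image inj_on_subset[OF inj_tangent_ln[OF two]])
  have disc: "(- 2 * y)\<^sup>2 - 4 * z * x = 2\<^sup>2 * qf v"
    by (simp add: v power2_eq_square algebra_simps)
  have square: "(\<exists>e. 2\<^sup>2 * qf v = e\<^sup>2) \<longleftrightarrow> (\<exists>e. qf v = e\<^sup>2)"
  proof
    assume "\<exists>e. 2\<^sup>2 * qf v = e\<^sup>2"
    then obtain e where "2\<^sup>2 * qf v = e\<^sup>2" ..
    then have "qf v = (e / 2)\<^sup>2"
      using four_neq_zero[OF two] by (simp add: power_divide nonzero_eq_divide_eq mult.commute)
    then show "\<exists>e. qf v = e\<^sup>2" ..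
  next
    assume "\<exists>e. qf v = e\<^sup>2"
    then obtain e where "qf v = e\<^sup>2" ..
    then have "2\<^sup>2 * qf v = (2 * e)\<^sup>2" by (simp only: power_mult_distrib)
    then show "\<exists>e. 2\<^sup>2 * qf v = e\<^sup>2" ..
  qed
  show ?thesis
    unfolding external_def card card_roots[OF two nz'] disc square
    using four_neq_zero[OF two] by simp
qed

section \<open>Normalized representatives of the external points\<close>

lemma neq_0_if_qf_1: "qf v = 1 \<Longrightarrow> v \<noteq> 0"
  using qf_zero zero_neq_one by metis

lemma external_cases:
  fixes X :: "'a::{field,finite} point"
  assumes two: "(2 :: 'a) \<noteq> 0" and "external X"
  obtains v where "qf v = 1" "X = abs_point v"
proof -
  obtain u where u: "u \<noteq> 0" "X = abs_point u" by (rule point_cases)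
  have "qf u \<noteq> 0 \<and> (\<exists>e. qf u = e\<^sup>2)"
    using external_abs_point[OF two u(1)] assms(2) unfolding u(2) by blast
  then obtain e where e: "qf u = e\<^sup>2" "e \<noteq> 0" by auto
  have "qf (scl (1 / e) u) = 1" using e by (simp add: power_divide)
  moreover from this have "scl (1 / e) u \<noteq> 0" by (rule neq_0_if_qf_1)
  then have "abs_point u = abs_point (scl (1 / e) u)"
    using u(1) e(2) by (subst abs_point_eq_iff) (auto intro!: exI[of _ "1 / e"])
  ultimately show ?thesis using that[of "scl (1 / e) u"] u(2) by simp
qed

text \<open>The coordinates \<open>(z, - 2 * y, x)\<close> of the polar represent the linear form
  \<open>- bf u\<close>.\<close>

lemma lies_on_perp:
  fixes u v :: "'a::field vec3"
  assumes two: "(2 :: 'a) \<noteq> 0" and nz: "u \<noteq> 0" "v \<noteq> 0"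
  shows "lies_on (abs_point v) (perp (abs_point u)) \<longleftrightarrow> bf u v = 0"
proof -
  obtain x y z x' y' z' where uv: "u = (x, y, z)" "v = (x', y', z')" by (cases u, cases v) auto
  have nz': "(z, - 2 * y, x) \<noteq> 0" using nz two by (auto simp: uv zero_prod_def)
  have "perp (abs_point u) = abs_line (z, - 2 * y, x)"
    using perp_abs_point[OF two] nz(1) by (simp add: uv zero_prod_def)
  then have "lies_on (abs_point v) (perp (abs_point u)) \<longleftrightarrow> x' * z + y' * (- 2 * y) + z' * x = 0"
    using lies_on_abs[OF nz(2) nz'] by (simp add: uv)
  also have "x' * z + y' * (- 2 * y) + z' * x = - bf u v" by (simp add: uv algebra_simps)
  finally show ?thesis by simp
qed

lemma unit_vectors_external:
  fixes P :: "nat \<Rightarrow> 'a::{field,finite} point"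
  assumes two: "(2 :: 'a) \<noteq> 0" and P: "bij_betw P {0..<n} {X. external X}"
  obtains p where "unit_vectors {0..<n} p" "\<And>i. i < n \<Longrightarrow> P i = abs_point (p i)"
proof -
  have "\<exists>v. qf v = 1 \<and> P i = abs_point v" if "i < n" for i
  proof -
    have "external (P i)" using bij_betwE[OF P] that by auto
    then show ?thesis using external_cases[OF two] by blast
  qed
  then have "\<forall>i. \<exists>v. i < n \<longrightarrow> qf v = 1 \<and> P i = abs_point v" by blast
  then obtain p where p: "qf (p i) = 1" "P i = abs_point (p i)" if "i < n" for i
    using choice[of "\<lambda>i v. i < n \<longrightarrow> qf v = 1 \<and> P i = abs_point v"] by blast
  \<comment> \<open>A factor \<open>c\<close> between two vectors with \<open>qf = 1\<close>
    satisfies \<open>c\<^sup>2 = 1\<close>.\<close>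
  have eq_iff: "abs_point u = abs_point v \<longleftrightarrow> v = u \<or> v = - u" if "qf u = 1" "qf v = 1" for u v :: "'a vec3"
  proof -
    have "(\<exists>c. c \<noteq> 0 \<and> v = scl c u) \<longleftrightarrow> v = u \<or> v = - u"
    proof
      assume "\<exists>c. c \<noteq> 0 \<and> v = scl c u"
      then obtain c where c: "v = scl c u" by auto
      then have "c = 1 \<or> c = - 1" using that by (simp add: power2_eq_1_iff)
      then show "v = u \<or> v = - u" using c by auto
    next
      assume "v = u \<or> v = - u"
      then show "\<exists>c. c \<noteq> 0 \<and> v = scl c u"
        by (auto intro: exI[of _ 1] exI[of _ "- 1"])
    qed
    then show ?thesis unfolding abs_point_eq_iff[OF that[THEN neq_0_if_qf_1]] .
  qed
  have "unit_vectors {0..<n} p"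
  proof
    fix v :: "'a vec3" assume v: "qf v = 1"
    then have "external (abs_point v)"
      unfolding external_abs_point[OF two neq_0_if_qf_1[OF v]] by (auto intro: exI[of _ 1])
    then have "abs_point v \<in> P ` {0..<n}" using bij_betw_imp_surj_on[OF P] by simp
    then obtain i where "i \<in> {0..<n}" "P i = abs_point v" by auto
    then have "\<exists>!i. i \<in> {0..<n} \<and> P i = abs_point v"
      using inj_onD[OF bij_betw_imp_inj_on[OF P]] by (intro ex1I[of _ i]) simp_all
    moreover have "i \<in> {0..<n} \<and> P i = abs_point v \<longleftrightarrow> i \<in> {0..<n} \<and> (v = p i \<or> v = - p i)" for i
    proof (cases "i < n")
      case True
      then show ?thesis using eq_iff[OF p(1)[OF True] v] by (simp add: p(2))
    qed simp
    ultimately show "\<exists>!i. i \<in> {0..<n} \<and> (v = p i \<or> v = - p i)" by simp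
  qed (use two p in simp_all)
  then show ?thesis using that p by blast
qed

section \<open>The matrix powers\<close>

lemma mat_mult_index:
  "A \<in> carrier_mat n n \<Longrightarrow> B \<in> carrier_mat n n \<Longrightarrow> i < n \<Longrightarrow> j < n \<Longrightarrow>
    (A * B) $$ (i, j) = (\<Sum>k\<in>{0..<n}. A $$ (i, k) * B $$ (k, j))"
  by (auto simp: scalar_prod_def intro!: sum.cong)

locale orthogonality_mat = unit_vectors "{0..<n}" p
  for n and p :: "nat \<Rightarrow> 'a::{field,finite} vec3" +
  fixes B :: "int mat"
  assumes B: "B \<in> carrier_mat n n"
    and adj: "i < n \<Longrightarrow> j < n \<Longrightarrow> B $$ (i, j) = of_bool (bf (p i) (p j) = 0)"
begin

text \<open>The entries of the matrix \<open>T\<close>.\<close>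

definition tgt_entry :: "nat \<Rightarrow> nat \<Rightarrow> int" where
  "tgt_entry i j = of_bool ((\<exists>r :: 'a. r\<^sup>2 = 2) \<and> tgt i j)"

lemma even_cube_diff:
  assumes ij: "i < n" "j < n"
  shows "even ((B * B * B) $$ (i, j) - (B $$ (i, j) + tgt_entry i j))"
proof -
  have "(B * B * B) $$ (i, j) =
      (\<Sum>k\<in>{0..<n}. \<Sum>l\<in>{0..<n}. B $$ (i, k) * B $$ (k, l) * B $$ (l, j))"
    using ij B
    by (simp add: mat_mult_index[where n = n] sum_distrib_left mult.assoc del: index_mult_mat)
  also have "\<dots> = (\<Sum>(k, l)\<in>{0..<n} \<times> {0..<n}. of_bool ((k, l) \<in> paths i j))"
    unfolding sum.cartesian_product using ij by (intro sum.cong) (auto simp: adj paths_def)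
  also have "\<dots> = int (card (paths i j))"
  proof -
    have "({0..<n} \<times> {0..<n}) \<inter> paths i j = paths i j" by (auto simp: paths_def)
    then show ?thesis by (simp add: case_prod_unfold of_bool_def sum.If_cases)
  qed
  finally have "(B * B * B) $$ (i, j) = int (card (paths i j))" .
  \<comment> \<open>Orthogonality and tangency exclude each other, so the sum of the two entries has
    the parity of the disjunction.\<close>
  moreover have "\<not> tgt i j" if "bf (p i) (p j) = 0"
    using that four_neq_0 by (auto simp: tgt_def)
  ultimately show ?thesis
    using odd_card_paths[of i j] ij by (auto simp: adj tgt_entry_def)
qed

lemma even_tgt_mult_diff:
  assumes ij: "i < n" "j < n"
  shows "even ((\<Sum>k\<in>{0..<n}. tgt_entry i k * B $$ (k, j)) - tgt_entry i j)"
proof (cases "\<exists>r :: 'a. r\<^sup>2 = 2")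
  case True
  have "(\<Sum>k\<in>{0..<n}. tgt_entry i k * B $$ (k, j)) =
      (\<Sum>k\<in>{0..<n}. of_bool (tgt i k \<and> bf (p k) (p j) = 0))"
    using ij True by (intro sum.cong) (auto simp: tgt_entry_def adj)
  also have "\<dots> = int (card {k \<in> {0..<n}. tgt i k \<and> bf (p k) (p j) = 0})"
    by (simp add: of_bool_def sum.If_cases Int_def)
  finally show ?thesis
    using odd_card_tgt_orthogonal[of i j] ij True by (auto simp: tgt_entry_def)
qed (simp add: tgt_entry_def)

text \<open>Carries a congruence \<open>X = Y + T\<close> to the next power of \<open>B\<close>,
  because \<open>T B = T\<close> modulo 2.\<close>

lemma even_mult_diff:
  assumes XY: "X \<in> carrier_mat n n" "Y \<in> carrier_mat n n"
    and even: "\<And>k. k < n \<Longrightarrow> even (X $$ (i, k) - (Y $$ (i, k) + tgt_entry i k))"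
    and ij: "i < n" "j < n"
  shows "even ((X * B) $$ (i, j) - ((Y * B) $$ (i, j) + tgt_entry i j))"
proof -
  have "even (\<Sum>k\<in>{0..<n}. (X $$ (i, k) - (Y $$ (i, k) + tgt_entry i k)) * B $$ (k, j))"
    using even by (intro dvd_sum dvd_mult2) simp
  moreover have "(\<Sum>k\<in>{0..<n}. (X $$ (i, k) - (Y $$ (i, k) + tgt_entry i k)) * B $$ (k, j)) =
      (X * B) $$ (i, j) - (Y * B) $$ (i, j) - (\<Sum>k\<in>{0..<n}. tgt_entry i k * B $$ (k, j))"
    unfolding mat_mult_index[OF XY(1) B ij] mat_mult_index[OF XY(2) B ij]
    by (simp add: left_diff_distrib distrib_right sum_subtractf sum.distrib)
  ultimately show ?thesis using even_tgt_mult_diff[OF ij] by presburger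
qed

lemma pow_5_cong:
  assumes ij: "i < n" "j < n"
  shows "[(B ^\<^sub>m 5) $$ (i, j) = B $$ (i, j)] (mod 2)"
proof -
  have pow: "B ^\<^sub>m 5 = B * B * B * B * B"
    using B by (simp add: numeral_eq_Suc)
  have "even ((B * B * B * B) $$ (i, k) - ((B * B) $$ (i, k) + tgt_entry i k))" if "k < n" for k
    using even_mult_diff[of "B * B * B" B i k] even_cube_diff ij that B by simp
  then have "even ((B * B * B * B * B) $$ (i, j) - ((B * B * B) $$ (i, j) + tgt_entry i j))"
    using even_mult_diff[of "B * B * B * B" "B * B" i j] ij B by simp
  \<comment> \<open>\<open>T\<close> now occurs twice and cancels modulo 2.\<close>
  then have "even ((B * B * B * B * B) $$ (i, j) - B $$ (i, j))"
    using even_cube_diff[OF ij] by presburger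
  then show ?thesis unfolding pow by (simp add: cong_iff_dvd_diff)
qed

lemma pow_3_cong:
  assumes "\<nexists>r :: 'a. r\<^sup>2 = 2" and ij: "i < n" "j < n"
  shows "[(B ^\<^sub>m 3) $$ (i, j) = B $$ (i, j)] (mod 2)"
proof -
  have pow: "B ^\<^sub>m 3 = B * B * B" using B by (simp add: numeral_eq_Suc)
  have "tgt_entry i j = 0" using assms(1) by (simp add: tgt_entry_def)
  then show ?thesis
    using even_cube_diff[OF ij] unfolding pow cong_iff_dvd_diff by (simp only: add_0_right)
qed

end

theorem theorem2p1:
  fixes P :: "nat \<Rightarrow> 'a::{field,finite} point" and q n :: nat and B :: "int mat"
  assumes "q = CARD('a)" and "odd q"
    and "n = q * (q + 1) div 2"
    and "bij_betw P {0..<n} {X. external X}"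
    and "B = incidence_mat n P"
  shows "(\<forall>i<n. \<forall>j<n. [(B ^\<^sub>m 5) $$ (i, j) = B $$ (i, j)] (mod 2)) \<and>
    ([int q = 3] (mod 8) \<or> [int q = - 3] (mod 8) \<longrightarrow>
      (\<forall>i<n. \<forall>j<n. [(B ^\<^sub>m 3) $$ (i, j) = B $$ (i, j)] (mod 2)))"
proof -
  have two: "(2 :: 'a) \<noteq> 0" using two_neq_zero_of_odd_card assms(1,2) by blast
  obtain p where "unit_vectors {0..<n} p" and P: "\<And>i. i < n \<Longrightarrow> P i = abs_point (p i)"
    using unit_vectors_external[OF two assms(4)] by blast
  then interpret unit_vectors "{0..<n}" p by simp
  interpret orthogonality_mat n p B
  proof
    show "B \<in> carrier_mat n n" by (simp add: assms(5) incidence_mat_def)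
    show "B $$ (i, j) = of_bool (bf (p i) (p j) = 0)" if "i < n" "j < n" for i j
      using that p_neq_0 lies_on_perp[OF two, of "p i" "p j"]
      by (simp add: assms(5) incidence_mat_def P)
  qed
  \<comment> \<open>The residues 3 and 5 modulo 8 differ from the residues 1 and 7 that a square
    root of 2 forces.\<close>
  have "\<nexists>r :: 'a. r\<^sup>2 = 2" if q: "[int q = 3] (mod 8) \<or> [int q = - 3] (mod 8)"
  proof
    assume "\<exists>r :: 'a. r\<^sup>2 = 2"
    then have "q mod 8 = 1 \<or> q mod 8 = 7"
      using card_mod_8_if_two_square[OF two] assms(1) by blast
    then have "int q mod 8 = 1 \<or> int q mod 8 = 7" by presburger
    then show False using q by (auto simp: cong_def)
  qed
  then show ?thesis
    using pow_5_cong pow_3_cong by blast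
qed

end
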